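(* Let $r$ and $s$ be positive integers with $r\geq 2s-2$, and let $G$ be a finite simple graph of order $n=3r+4s$ with $\sigma_{2}(G)\geq n+r$. Then $G$ contains $r$ triangles and $s$ quadrilaterals, all pairwise vertex-disjoint (i.e. $G\supseteq rC_{3}\cup sC_{4}$).
   Context: All graphs are finite, simple and undirected. For a graph $G$, $\sigma_{2}(G)=\min\{d(x)+d(y): x,y\in V(G),\ x\neq y,\ xy\notin E(G)\}$, where $d(v)$ is the degree of $v$; if $G$ is complete, $\sigma_2(G)=\infty$. $C_3$ is a triangle (cycle on 3 vertices) and $C_4$ a quadrilateral (cycle on 4 vertices); $rC_3\cup sC_4$ denotes $r+s$ vertex-disjoint cycles, $r$ of length 3 and $s$ of length 4, and containment means as (not necessarily induced) subgraphs. *)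

theory Defs
  imports Main "HOL-Library.Extended_Nat"
begin

definition simple_graph :: "'a set \<Rightarrow> ('a \<Rightarrow> 'a \<Rightarrow> bool) \<Rightarrow> bool" where
  "simple_graph V E \<longleftrightarrow> finite V \<and> (\<forall>x y. E x y \<longrightarrow> x \<in> V \<and> y \<in> V)
     \<and> (\<forall>x y. E x y \<longrightarrow> E y x) \<and> (\<forall>x. \<not> E x x)"

definition degree :: "'a set \<Rightarrow> ('a \<Rightarrow> 'a \<Rightarrow> bool) \<Rightarrow> 'a \<Rightarrow> nat" where
  "degree V E x = card {y \<in> V. E x y}"

text \<open>sigma_2 as an extended natural number (infinity for complete graphs).\<close>
definition sigma2 :: "'a set \<Rightarrow> ('a \<Rightarrow> 'a \<Rightarrow> bool) \<Rightarrow> enat" where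
  "sigma2 V E = (INF p \<in> {(x, y). x \<in> V \<and> y \<in> V \<and> x \<noteq> y \<and> \<not> E x y}.
                   enat (degree V E (fst p) + degree V E (snd p)))"

definition is_triangle :: "'a set \<Rightarrow> ('a \<Rightarrow> 'a \<Rightarrow> bool) \<Rightarrow> 'a set \<Rightarrow> bool" where
  "is_triangle V E S \<longleftrightarrow> (\<exists>a b c. S = {a, b, c} \<and> distinct [a, b, c]
      \<and> S \<subseteq> V \<and> E a b \<and> E b c \<and> E c a)"

definition is_quad :: "'a set \<Rightarrow> ('a \<Rightarrow> 'a \<Rightarrow> bool) \<Rightarrow> 'a set \<Rightarrow> bool" where
  "is_quad V E S \<longleftrightarrow> (\<exists>a b c d. S = {a, b, c, d} \<and> distinct [a, b, c, d]
      \<and> S \<subseteq> V \<and> E a b \<and> E b c \<and> E c d \<and> E d a)"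

end

theory Submission
  imports Defs
begin

text \<open>
  Adding edges one at a time, we may assume that \<open>G + uv\<close> has the required packing for some
  non-adjacent \<open>u, v\<close>. Deleting \<open>uv\<close> leaves \<open>G\<close> with either a spanning packing of
  \<open>r\<close> triangles, \<open>s - 1\<close> quadrilaterals and a path on four vertices, or one of \<open>r - 1\<close> triangles,
  \<open>s\<close> quadrilaterals and a path on three vertices.

  Put \<open>k = r + s\<close>, so non-adjacent vertices have degree sum at least \<open>4k\<close>: four edges per cycle of
  the packing. From a three-vertex path \<open>xzy\<close>, counting the edges at \<open>{x, y}\<close> leads to a four-vertex
  path or to a triangle \<open>abc\<close> receiving five edges; in the latter case
  \<open>d(x) + d(y) + 2d(z) + 2d(c)\<close> is too small. From a four-vertex path, counting the edges at
  its four vertices gives the quadrilateral or one more triangle, hence \<open>r + 1\<close> triangles,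
  \<open>s - 1\<close> quadrilaterals and a single vertex \<open>d\<close>. Now \<open>d\<close> sends at most one edge to each
  triangle, and for a suitable triangle \<open>xyz\<close> with \<open>y, z\<close> not adjacent to \<open>d\<close> the sum
  \<open>2d(d) + d(y) + d(z)\<close> is at most 6 on every triangle and 12 on every quadrilateral.
  This is less than \<open>8k\<close> in total because \<open>r \<ge> 2s - 2\<close>.
\<close>

subsection \<open>Neighbours in a set\<close>

definition nb :: "('a \<Rightarrow> 'a \<Rightarrow> bool) \<Rightarrow> 'a \<Rightarrow> 'a set \<Rightarrow> nat" where
  "nb E v S = card {y \<in> S. E v y}"

lemma nb_empty [simp]: "nb E v {} = 0"
  by (simp add: nb_def)

lemma nb_insert [simp]:
  assumes "finite S" "a \<notin> S"
  shows "nb E v (insert a S) = of_bool (E v a) + nb E v S"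
proof -
  have "{y \<in> insert a S. E v y} = (if E v a then insert a {y \<in> S. E v y} else {y \<in> S. E v y})"
    by auto
  then show ?thesis
    using assms by (simp add: nb_def)
qed

lemma nb_le_card: "finite S \<Longrightarrow> nb E v S \<le> card S"
  unfolding nb_def by (rule card_mono) auto

lemma nb_Un:
  assumes "finite S" "finite T" "S \<inter> T = {}"
  shows "nb E v (S \<union> T) = nb E v S + nb E v T"
proof -
  have "{y \<in> S \<union> T. E v y} = {y \<in> S. E v y} \<union> {y \<in> T. E v y}"
    by auto
  then show ?thesis
    unfolding nb_def using assms by (subst card_Un_disjoint [symmetric]) auto
qed

lemma nb_Union:
  assumes "finite F" "\<And>C. C \<in> F \<Longrightarrow> finite C" "pairwise disjnt F"
  shows "nb E v (\<Union>F) = (\<Sum>C\<in>F. nb E v C)"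
  using assms
proof (induction F rule: finite_induct)
  case (insert C F)
  have "C \<inter> \<Union>F = {}"
    using insert.prems insert.hyps by (auto simp: pairwise_insert disjnt_def)
  then have "nb E v (C \<union> \<Union>F) = nb E v C + nb E v (\<Union>F)"
    using insert by (intro nb_Un) auto
  then show ?case
    using insert by (simp add: pairwise_insert)
qed simp

subsection \<open>Packings\<close>

definition family :: "('a \<Rightarrow> 'a \<Rightarrow> bool) \<Rightarrow> 'a set \<Rightarrow> 'a set set \<Rightarrow> 'a set set \<Rightarrow> bool" where
  "family E W TT QQ \<longleftrightarrow> finite TT \<and> finite QQ \<and> (\<forall>T\<in>TT. is_triangle W E T)
     \<and> (\<forall>Q\<in>QQ. is_quad W E Q) \<and> pairwise disjnt (TT \<union> QQ)"

text \<open>The cycles need not cover \<open>W\<close>. Whenever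
  \<open>card W = 3 * r + 4 * s\<close> covering is automatic, by counting vertices, and
  \<open>nb_family\<close> exploits this.\<close>

definition packs :: "('a \<Rightarrow> 'a \<Rightarrow> bool) \<Rightarrow> 'a set \<Rightarrow> nat \<Rightarrow> nat \<Rightarrow> bool" where
  "packs E W r s \<longleftrightarrow> (\<exists>TT QQ. family E W TT QQ \<and> card TT = r \<and> card QQ = s)"

text \<open>Separates the position of a cycle from its shape, so that the ambient set can be
  enlarged or shrunk freely.\<close>

lemma is_triangle_iff: "is_triangle W E T \<longleftrightarrow> T \<subseteq> W \<and> is_triangle UNIV E T"
  unfolding is_triangle_def by (simp only: subset_UNIV simp_thms) metis

lemma is_quad_iff: "is_quad W E Q \<longleftrightarrow> Q \<subseteq> W \<and> is_quad UNIV E Q"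
  unfolding is_quad_def by (simp only: subset_UNIV simp_thms) metis

lemma is_triangleD: "is_triangle W E T \<Longrightarrow> T \<subseteq> W \<and> finite T \<and> card T = 3"
  unfolding is_triangle_def by (elim exE conjE, intro conjI) simp_all

lemma is_quadD: "is_quad W E Q \<Longrightarrow> Q \<subseteq> W \<and> finite Q \<and> card Q = 4"
  unfolding is_quad_def by (elim exE conjE, intro conjI) simp_all

lemma is_triangleE:
  assumes "is_triangle W E T"
  obtains a b c where "T = {a, b, c}" "distinct [a, b, c]" "T \<subseteq> W" "E a b" "E b c" "E c a"
  using assms unfolding is_triangle_def by (elim exE conjE) (rule that)

lemma is_quadE:
  assumes "is_quad W E Q"
  obtains a b c d where "Q = {a, b, c, d}" "distinct [a, b, c, d]" "Q \<subseteq> W"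
    "E a b" "E b c" "E c d" "E d a"
  using assms unfolding is_quad_def by (elim exE conjE) (rule that)

lemma family_disjoint_kinds: "family E W TT QQ \<Longrightarrow> TT \<inter> QQ = {}"
  unfolding family_def using is_triangleD[of W E] is_quadD[of W E] by fastforce

lemma family_memD:
  assumes "family E W TT QQ" "C \<in> TT \<union> QQ"
  shows "C \<subseteq> W" "finite C" "C \<noteq> {}"
  using assms is_triangleD[of W E C] is_quadD[of W E C] by (auto simp: family_def)

lemma family_mono: "family E W TT QQ \<Longrightarrow> W \<subseteq> W' \<Longrightarrow> family E W' TT QQ"
  unfolding family_def is_triangle_iff[of W] is_triangle_iff[of W']
    is_quad_iff[of W] is_quad_iff[of W'] by auto

lemma packs_mono: "packs E W r s \<Longrightarrow> W \<subseteq> W' \<Longrightarrow> packs E W' r s"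
  unfolding packs_def using family_mono by blast

lemma packs_0: "packs E W 0 0"
  unfolding packs_def family_def by (intro exI[of _ "{}"]) auto

text \<open>Cycles are nonempty, so cycles from disjoint ground sets are distinct and the two counts
  add up.\<close>

lemma packs_Un:
  assumes "packs E W r s" "packs E W' r' s'" "W \<inter> W' = {}"
  shows "packs E (W \<union> W') (r + r') (s + s')"
proof -
  obtain TT QQ where F: "family E W TT QQ" and c: "card TT = r" "card QQ = s"
    using assms by (auto simp: packs_def)
  obtain TT' QQ' where F': "family E W' TT' QQ'" and c': "card TT' = r'" "card QQ' = s'"
    using assms by (auto simp: packs_def)
  have sep: "disjnt C C'" if "C \<in> TT \<union> QQ" "C' \<in> TT' \<union> QQ'" for C C'
    using family_memD(1)[OF F that(1)] family_memD(1)[OF F' that(2)] assms(3)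
    by (auto simp: disjnt_def)
  have ne: "C \<noteq> C'" if "C \<in> TT \<union> QQ" "C' \<in> TT' \<union> QQ'" for C C'
    using sep[OF that] family_memD(3)[OF F that(1)] by (auto simp: disjnt_def)
  have "pairwise disjnt ((TT \<union> TT') \<union> (QQ \<union> QQ'))"
    using F F' sep unfolding family_def pairwise_def by (metis Un_iff disjnt_sym)
  moreover have "is_triangle (W \<union> W') E T" if "T \<in> TT \<union> TT'" for T
    using that F F' is_triangle_iff[of _ E T] unfolding family_def by (metis Un_iff le_supI1 le_supI2)
  moreover have "is_quad (W \<union> W') E T" if "T \<in> QQ \<union> QQ'" for T
    using that F F' is_quad_iff[of _ E T] unfolding family_def by (metis Un_iff le_supI1 le_supI2)
  ultimately have "family E (W \<union> W') (TT \<union> TT') (QQ \<union> QQ')"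
    using F F' by (auto simp: family_def)
  moreover have "TT \<inter> TT' = {}" "QQ \<inter> QQ' = {}"
    using ne by blast+
  ultimately show ?thesis
    using F F' c c' unfolding packs_def
    by (intro exI[of _ "TT \<union> TT'"] exI[of _ "QQ \<union> QQ'"]) (auto simp: family_def card_Un_disjoint)
qed

text \<open>The exchange principle behind every local improvement: the cycles in \<open>A\<close>
  and \<open>B\<close> are given up and those packed in \<open>S\<close> are gained. The surviving
  cycles avoid the vertices of \<open>A\<close> and \<open>B\<close>, and \<open>S\<close> may also
  use vertices outside \<open>W\<close>.\<close>

lemma family_replace:
  assumes F: "family E W TT QQ" and "A \<subseteq> TT" "B \<subseteq> QQ"
    and S: "packs E S r s" and disj: "S \<inter> (W - \<Union>A - \<Union>B) = {}"
  shows "packs E ((W - \<Union>A - \<Union>B) \<union> S) (card TT - card A + r) (card QQ - card B + s)"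
proof -
  let ?W = "W - \<Union>A - \<Union>B"
  have sub: "C \<subseteq> ?W" if "C \<in> (TT - A) \<union> (QQ - B)" for C
  proof -
    have "disjnt C D" if "D \<in> A \<union> B" for D
    proof -
      have "C \<noteq> D"
        using \<open>C \<in> (TT - A) \<union> (QQ - B)\<close> that assms(2,3) family_disjoint_kinds[OF F] by blast
      then show ?thesis
        using F \<open>C \<in> (TT - A) \<union> (QQ - B)\<close> that assms(2,3)
        unfolding family_def pairwise_def by blast
    qed
    moreover have "C \<subseteq> W"
      using family_memD(1)[OF F] that by blast
    ultimately show ?thesis
      unfolding disjnt_def by blast
  qed
  have "pairwise disjnt ((TT - A) \<union> (QQ - B))"
    using F unfolding family_def pairwise_def by blast
  then have "family E ?W (TT - A) (QQ - B)"
    using F sub is_triangle_iff[of _ E] is_quad_iff[of _ E]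
    unfolding family_def by (metis DiffD1 Un_iff finite_Diff)
  moreover have "card (TT - A) = card TT - card A" "card (QQ - B) = card QQ - card B"
    using F assms(2,3) by (auto simp: family_def card_Diff_subset finite_subset)
  ultimately have "packs E ?W (card TT - card A) (card QQ - card B)"
    unfolding packs_def by blast
  then show ?thesis
    using packs_Un[OF _ S] disj by blast
qed

lemma packs_triangle:
  assumes "E a b" "E b c" "E c a" "distinct [a, b, c]"
  shows "packs E {a, b, c} 1 0"
  unfolding packs_def family_def is_triangle_def
  by (rule exI[of _ "{{a, b, c}}"], rule exI[of _ "{}"]) (use assms in \<open>auto; blast\<close>)

lemma packs_quad:
  assumes "E a b" "E b c" "E c d" "E d a" "distinct [a, b, c, d]"
  shows "packs E {a, b, c, d} 0 1"
  unfolding packs_def family_def is_quad_def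
  by (rule exI[of _ "{}"], rule exI[of _ "{{a, b, c, d}}"]) (use assms in \<open>auto; blast\<close>)

lemma card_Union_family:
  assumes F: "family E W TT QQ"
  shows "card (\<Union>TT \<union> \<Union>QQ) = 3 * card TT + 4 * card QQ"
proof -
  have "card (\<Union>(TT \<union> QQ)) = (\<Sum>C\<in>TT \<union> QQ. card C)"
    using F family_memD(2)[OF F] by (intro card_Union_disjoint) (auto simp: family_def)
  also have "\<dots> = (\<Sum>C\<in>TT. card C) + (\<Sum>C\<in>QQ. card C)"
    using F family_disjoint_kinds[OF F] by (intro sum.union_disjoint) (auto simp: family_def)
  also have "(\<Sum>C\<in>TT. card C) = (\<Sum>C\<in>TT. 3)"
    using F is_triangleD[of W E] by (intro sum.cong) (auto simp: family_def)
  also have "(\<Sum>C\<in>QQ. card C) = (\<Sum>C\<in>QQ. 4)"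
    using F is_quadD[of W E] by (intro sum.cong) (auto simp: family_def)
  finally show ?thesis
    by simp
qed

text \<open>The cardinality of \<open>W\<close> forces the cycles to cover it, so the neighbours of
  \<open>v\<close> split exactly among the cycles and the remainder \<open>R\<close>.\<close>

lemma nb_family:
  assumes F: "family E W TT QQ" and W: "finite W" "card W = 3 * card TT + 4 * card QQ"
    and R: "finite R" "R \<inter> W = {}"
  shows "nb E v (W \<union> R) = nb E v R + (\<Sum>C\<in>TT. nb E v C) + (\<Sum>C\<in>QQ. nb E v C)"
proof -
  have "\<Union>(TT \<union> QQ) = W"
    using W card_Union_family[OF F] family_memD(1)[OF F] 
    by (intro card_subset_eq) (auto simp: Union_Un_distrib)
  moreover have "nb E v (\<Union>(TT \<union> QQ)) = (\<Sum>C\<in>TT \<union> QQ. nb E v C)"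
    using F family_memD(2)[OF F] by (intro nb_Union) (auto simp: family_def)
  moreover have "\<dots> = (\<Sum>C\<in>TT. nb E v C) + (\<Sum>C\<in>QQ. nb E v C)"
    using F family_disjoint_kinds[OF F] by (intro sum.union_disjoint) (auto simp: family_def)
  ultimately show ?thesis
    using nb_Un[of W R E v] W R by (auto simp: Int_commute)
qed

section \<open>Small packings from explicit edges\<close>

lemma packs_2_0:
  assumes "E a b" "E b c" "E c a" "E d e" "E e f" "E f d"
    "distinct [a, b, c, d, e, f]" "{a, b, c, d, e, f} \<subseteq> W"
  shows "packs E W 2 0"
  using packs_Un[OF packs_triangle[of E a b c] packs_triangle[of E d e f]] assms
  by (auto intro: packs_mono simp: numeral_2_eq_2)

lemma packs_1_1:
  assumes "E a b" "E b c" "E c a" "E p q" "E q u" "E u v" "E v p"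
    "distinct [a, b, c, p, q, u, v]" "{a, b, c, p, q, u, v} \<subseteq> W"
  shows "packs E W 1 1"
  using packs_Un[OF packs_triangle[of E a b c] packs_quad[of E p q u v]] assms
  by (auto intro: packs_mono)

lemma packs_0_2:
  assumes "E a b" "E b c" "E c d" "E d a" "E p q" "E q u" "E u v" "E v p"
    "distinct [a, b, c, d, p, q, u, v]" "{a, b, c, d, p, q, u, v} \<subseteq> W"
  shows "packs E W 0 2"
  using packs_Un[OF packs_quad[of E a b c d] packs_quad[of E p q u v]] assms
  by (auto intro: packs_mono simp: numeral_2_eq_2)

lemma packs_3_0:
  assumes "E a b" "E b c" "E c a" "E d e" "E e f" "E f d" "E u v" "E v w" "E w u"
    "distinct [a, b, c, d, e, f, u, v, w]" "{a, b, c, d, e, f, u, v, w} \<subseteq> W"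
  shows "packs E W 3 0"
proof -
  have "packs E {a, b, c, d, e, f} 2 0"
    by (rule packs_2_0[of E a b c d e f]) (use assms in auto)
  from packs_Un[OF this packs_triangle[of E u v w]] show ?thesis
    using assms by (auto intro: packs_mono)
qed

text \<open>Integer sums of conditionals turn each local bound below into a finite Boolean problem
  for the SMT calls.\<close>

lemma int_nb_3:
  assumes "distinct [a, b, c]"
  shows "int (nb E v {a, b, c}) =
    (if E v a then 1 else 0) + (if E v b then 1 else 0) + (if E v c then 1 else 0)"
  using assms by simp

lemma int_nb_4:
  assumes "distinct [a, b, c, d]"
  shows "int (nb E v {a, b, c, d}) = (if E v a then 1 else 0) + (if E v b then 1 else 0)
    + (if E v c then 1 else 0) + (if E v d then 1 else 0)"
  using assms by simp

subsection \<open>Local exchanges\<close>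

locale symmetric_relation =
  fixes E :: "'a \<Rightarrow> 'a \<Rightarrow> bool"
  assumes commute: "E x y \<longleftrightarrow> E y x"
begin

section \<open>A path on four vertices against one cycle\<close>

text \<open>The triangle \<open>w x a\<close> is set aside. No quadrilateral may then arise from the
  edge \<open>y z\<close> and the path \<open>b c d\<close>, whether it uses one end of the edge
  (\<open>y b c d\<close>) or both (\<open>y b c z\<close>).\<close>

lemma common_neighbour_bound:
  assumes edges: "E w x" "E y z" "E a b" "E b c" "E c d" "E d a"
    and dist: "distinct [w, x, y, z, a, b, c, d]" "{w, x, y, z, a, b, c, d} \<subseteq> W"
    and no: "\<not> packs E W 1 1" and common: "E w a" "E x a"
  shows "nb E y {b, c, d} + nb E z {b, c, d} \<le> 2"
proof -
  have c0: "\<not> (E y b \<and> E y d)"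
    using packs_1_1[of E w x a y b c d W] no edges dist common by (auto simp: commute)
  have c1: "\<not> (E z b \<and> E z d)"
    using packs_1_1[of E w x a z b c d W] no edges dist common by (auto simp: commute)
  have c2: "\<not> (E y b \<and> E z c)"
    using packs_1_1[of E w x a y b c z W] no edges dist common by (auto simp: commute)
  have c3: "\<not> (E y c \<and> E z b)"
    using packs_1_1[of E w x a z b c y W] no edges dist common by (auto simp: commute)
  have c4: "\<not> (E y d \<and> E z c)"
    using packs_1_1[of E w x a y d c z W] no edges dist common by (auto simp: commute)
  have c5: "\<not> (E y c \<and> E z d)"
    using packs_1_1[of E w x a z d c y W] no edges dist common by (auto simp: commute)
  show ?thesis
    using dist(1) c0 c1 c2 c3 c4 c5 by auto
qed

text \<open>Each pattern would give a triangle and a quadrilateral among the eight vertices. Only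
  one labelling of the 4-cycle is treated; the symmetric patterns come from relabelling it.\<close>

lemma path_quad_exchanges:
  assumes edges: "E w x" "E x y" "E y z" "E a b" "E b c" "E c d" "E d a"
    and dist: "distinct [w, x, y, z, a, b, c, d]" "{w, x, y, z, a, b, c, d} \<subseteq> W"
    and no: "\<not> packs E W 1 1"
  shows "\<not> (E w c \<and> E w d \<and> E x b \<and> E y a)"
    "\<not> (E w d \<and> E x c \<and> E z a \<and> E z b)"
    "\<not> (E x c \<and> E x d \<and> E y b \<and> E z a)"
    "\<not> (E w b \<and> E w c \<and> E x a \<and> E z a)"
    "\<not> (E w b \<and> E w d \<and> E x a \<and> E y a)"
    "\<not> (E w b \<and> E x b \<and> E y a \<and> E y c)"
proof -
  show "\<not> (E w c \<and> E w d \<and> E x b \<and> E y a)"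
    using packs_1_1[of E w c d x y a b W] no edges dist by (auto simp: commute)
  show "\<not> (E w d \<and> E x c \<and> E z a \<and> E z b)"
    using packs_1_1[of E z a b w x c d W] no edges dist by (auto simp: commute)
  show "\<not> (E x c \<and> E x d \<and> E y b \<and> E z a)"
    using packs_1_1[of E x c d y z a b W] no edges dist by (auto simp: commute)
  show "\<not> (E w b \<and> E w c \<and> E x a \<and> E z a)"
    using packs_1_1[of E w b c x y z a W] no edges dist by (auto simp: commute)
  show "\<not> (E w b \<and> E w d \<and> E x a \<and> E y a)"
    using packs_1_1[of E x y a w b c d W] no edges dist by (auto simp: commute)
  show "\<not> (E w b \<and> E x b \<and> E y a \<and> E y c)"
    using packs_1_1[of E w x b y a d c W] no edges dist by (auto simp: commute)
qed

lemma path_quad_bound_heavy: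
  assumes edges: "E w x" "E x y" "E y z" "E a b" "E b c" "E c d" "E d a"
    and dist: "distinct [w, x, y, z, a, b, c, d]" "{w, x, y, z, a, b, c, d} \<subseteq> W"
    and no: "\<not> packs E W 1 1"
    and heavy: "nb E w {a, b, c, d} + nb E x {a, b, c, d} \<ge> 5"
  shows "nb E w {a, b, c, d} + nb E x {a, b, c, d} + nb E y {a, b, c, d} + nb E z {a, b, c, d} \<le> 8"
proof -
  let ?i = "\<lambda>v u. if E v u then 1 else 0 :: int"
  let ?n = "\<lambda>v. ?i v a + ?i v b + ?i v c + ?i v d"
  have rev: "E b a" "E c b" "E d c" "E a d"
    using edges commute by blast+
  have nb: "int (nb E v {a, b, c, d}) = ?n v" for v
    using dist(1) by simp
  \<comment> \<open>The facts \<open>x0\<close> to \<open>x7\<close> are the exchanges for the eight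
    symmetries of the 4-cycle: four rotations and four reflections.\<close>
  have x0: "distinct [w, x, y, z, a, b, c, d]" "{w, x, y, z, a, b, c, d} \<subseteq> W"
    using dist by auto
  note x0 = path_quad_exchanges[OF edges(1-3) edges(4) edges(5) edges(6) edges(7) x0 no]
  have x1: "distinct [w, x, y, z, b, c, d, a]" "{w, x, y, z, b, c, d, a} \<subseteq> W"
    using dist by auto
  note x1 = path_quad_exchanges[OF edges(1-3) edges(5) edges(6) edges(7) edges(4) x1 no]
  have x2: "distinct [w, x, y, z, c, d, a, b]" "{w, x, y, z, c, d, a, b} \<subseteq> W"
    using dist by auto
  note x2 = path_quad_exchanges[OF edges(1-3) edges(6) edges(7) edges(4) edges(5) x2 no]
  have x3: "distinct [w, x, y, z, d, a, b, c]" "{w, x, y, z, d, a, b, c} \<subseteq> W"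
    using dist by auto
  note x3 = path_quad_exchanges[OF edges(1-3) edges(7) edges(4) edges(5) edges(6) x3 no]
  have x4: "distinct [w, x, y, z, a, d, c, b]" "{w, x, y, z, a, d, c, b} \<subseteq> W"
    using dist by auto
  note x4 = path_quad_exchanges[OF edges(1-3) rev(4) rev(3) rev(2) rev(1) x4 no]
  have x5: "distinct [w, x, y, z, b, a, d, c]" "{w, x, y, z, b, a, d, c} \<subseteq> W"
    using dist by auto
  note x5 = path_quad_exchanges[OF edges(1-3) rev(1) rev(4) rev(3) rev(2) x5 no]
  have x6: "distinct [w, x, y, z, c, b, a, d]" "{w, x, y, z, c, b, a, d} \<subseteq> W"
    using dist by auto
  note x6 = path_quad_exchanges[OF edges(1-3) rev(2) rev(1) rev(4) rev(3) x6 no]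
  have x7: "distinct [w, x, y, z, d, c, b, a]" "{w, x, y, z, d, c, b, a} \<subseteq> W"
    using dist by auto
  note x7 = path_quad_exchanges[OF edges(1-3) rev(3) rev(2) rev(1) rev(4) x7 no]
  have c0: "E w a \<and> E x a \<longrightarrow> ?i y b + ?i y c + ?i y d + ?i z b + ?i z c + ?i z d \<le> 2"
    using common_neighbour_bound[OF edges(1,3) edges(4) edges(5) edges(6) edges(7) _ _ no] dist by auto
  have d0: "E y a \<and> E z a \<longrightarrow> ?i w b + ?i w c + ?i w d + ?i x b + ?i x c + ?i x d \<le> 2"
    using common_neighbour_bound[OF edges(3,1) edges(4) edges(5) edges(6) edges(7) _ _ no] dist by auto
  have c1: "E w b \<and> E x b \<longrightarrow> ?i y c + ?i y d + ?i y a + ?i z c + ?i z d + ?i z a \<le> 2"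
    using common_neighbour_bound[OF edges(1,3) edges(5) edges(6) edges(7) edges(4) _ _ no] dist by auto
  have d1: "E y b \<and> E z b \<longrightarrow> ?i w c + ?i w d + ?i w a + ?i x c + ?i x d + ?i x a \<le> 2"
    using common_neighbour_bound[OF edges(3,1) edges(5) edges(6) edges(7) edges(4) _ _ no] dist by auto
  have c2: "E w c \<and> E x c \<longrightarrow> ?i y d + ?i y a + ?i y b + ?i z d + ?i z a + ?i z b \<le> 2"
    using common_neighbour_bound[OF edges(1,3) edges(6) edges(7) edges(4) edges(5) _ _ no] dist by auto
  have d2: "E y c \<and> E z c \<longrightarrow> ?i w d + ?i w a + ?i w b + ?i x d + ?i x a + ?i x b \<le> 2"
    using common_neighbour_bound[OF edges(3,1) edges(6) edges(7) edges(4) edges(5) _ _ no] dist by auto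
  have c3: "E w d \<and> E x d \<longrightarrow> ?i y a + ?i y b + ?i y c + ?i z a + ?i z b + ?i z c \<le> 2"
    using common_neighbour_bound[OF edges(1,3) edges(7) edges(4) edges(5) edges(6) _ _ no] dist by auto
  have d3: "E y d \<and> E z d \<longrightarrow> ?i w a + ?i w b + ?i w c + ?i x a + ?i x b + ?i x c \<le> 2"
    using common_neighbour_bound[OF edges(3,1) edges(7) edges(4) edges(5) edges(6) _ _ no] dist by auto
  have heavy_int: "?n w + ?n x \<ge> 5"
    using heavy nb[of w] nb[of x] by linarith
  \<comment> \<open>A common neighbour of \<open>y\<close> and \<open>z\<close> would leave
    \<open>w\<close> and \<open>x\<close> at most 2 edges to the other three vertices and 2 to this
    one, fewer than five.\<close>
  have disj: "\<not> (E y a \<and> E z a)" "\<not> (E y b \<and> E z b)" "\<not> (E y c \<and> E z c)" "\<not> (E y d \<and> E z d)"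
    using heavy_int d0 d1 d2 d3 by (smt (verit))+
  show ?thesis
  proof (rule ccontr)
    assume "\<not> ?thesis"
    then have large: "?n w + ?n x + ?n y + ?n z \<ge> 9"
      using nb[of w] nb[of x] nb[of y] nb[of z] by linarith
    \<comment> \<open>With exactly five edges from \<open>w\<close> and \<open>x\<close>, they have
      a common neighbour; then \<open>y\<close> and \<open>z\<close> send at most 2 edges to the
      other vertices and, by \<open>disj\<close>, at most 1 to this one, so the total is at most
      8.\<close>
    have "?n w + ?n x \<ge> 6"
      using large heavy_int disj c0 c1 c2 c3 by (smt (verit))
    then show False
      using large disj c0 c1 c2 c3 x0 x1 x2 x3 x4 x5 x6 x7
      by (smt (verit))
  qed
qed

text \<open>If the total exceeds 8, one end edge of the path sends at least five edges to the
  quadrilateral; reversing the path makes this the edge \<open>w x\<close>.\<close>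

lemma path_quad_bound:
  assumes path: "E w x" "E x y" "E y z" "distinct [w, x, y, z]" "{w, x, y, z} \<subseteq> W"
    and quad: "is_quad W E Q" "{w, x, y, z} \<inter> Q = {}"
    and no: "\<not> packs E W 1 1"
  shows "nb E w Q + nb E x Q + nb E y Q + nb E z Q \<le> 8"
proof -
  obtain a b c d where Q: "Q = {a, b, c, d}" "distinct [a, b, c, d]" "Q \<subseteq> W"
    "E a b" "E b c" "E c d" "E d a"
    using quad(1) by (elim is_quadE)
  have rev: "E z y" "E y x" "E x w"
    using path commute by blast+
  have D: "distinct [w, x, y, z, a, b, c, d]" "{w, x, y, z, a, b, c, d} \<subseteq> W"
    and D': "distinct [z, y, x, w, a, b, c, d]" "{z, y, x, w, a, b, c, d} \<subseteq> W"
    using path(4,5) quad(2) Q(1-3) by auto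
  consider "nb E w Q + nb E x Q \<ge> 5" | "nb E z Q + nb E y Q \<ge> 5"
    | "nb E w Q + nb E x Q + nb E y Q + nb E z Q \<le> 8"
    by linarith
  then show ?thesis
  proof cases
    case 1
    then show ?thesis
      unfolding Q(1) by (rule path_quad_bound_heavy[OF path(1-3) Q(4-7) D no])
  next
    case 2
    then have "nb E z Q + nb E y Q + nb E x Q + nb E w Q \<le> 8"
      unfolding Q(1) by (rule path_quad_bound_heavy[OF rev Q(4-7) D' no])
    then show ?thesis
      by linarith
  qed
qed

text \<open>Each excluded pattern would give two disjoint triangles on the seven vertices. Any nine
  of the twelve possible edges contain such a pattern.\<close>

lemma path_triangle_bound:
  assumes path: "E w x" "E x y" "E y z" "distinct [w, x, y, z]" "{w, x, y, z} \<subseteq> W"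
    and tri: "is_triangle W E T" "{w, x, y, z} \<inter> T = {}"
    and no: "\<not> packs E W 2 0"
  shows "nb E w T + nb E x T + nb E y T + nb E z T \<le> 8"
proof -
  obtain a b c where T: "T = {a, b, c}" "distinct [a, b, c]" "T \<subseteq> W" "E a b" "E b c" "E c a"
    using tri(1) by (elim is_triangleE)
  have D: "distinct [w, x, y, z, a, b, c]" "{w, x, y, z, a, b, c} \<subseteq> W"
    using path(4,5) tri(2) T(1-3) by auto
  note edges = path(1-3) T(4-6)
  have c0: "\<not> (E w a \<and> E x a \<and> E y b \<and> E z b)"
    using packs_2_0[of E w x a y z b W] no edges D by (auto simp: commute)
  have c1: "\<not> (E w b \<and> E x b \<and> E y a \<and> E z a)"
    using packs_2_0[of E w x b y z a W] no edges D by (auto simp: commute)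
  have c2: "\<not> (E w c \<and> E x c \<and> E y a \<and> E y b)"
    using packs_2_0[of E w x c y a b W] no edges D by (auto simp: commute)
  have c3: "\<not> (E w a \<and> E w b \<and> E y c \<and> E z c)"
    using packs_2_0[of E w a b y z c W] no edges D by (auto simp: commute)
  have c4: "\<not> (E w c \<and> E x c \<and> E z a \<and> E z b)"
    using packs_2_0[of E w x c z a b W] no edges D by (auto simp: commute)
  have c5: "\<not> (E x a \<and> E x b \<and> E y c \<and> E z c)"
    using packs_2_0[of E x a b y z c W] no edges D by (auto simp: commute)
  have c6: "\<not> (E w a \<and> E w c \<and> E x b \<and> E y b)"
    using packs_2_0[of E w a c x y b W] no edges D by (auto simp: commute)
  have c7: "\<not> (E w b \<and> E w c \<and> E x a \<and> E y a)"
    using packs_2_0[of E w b c x y a W] no edges D by (auto simp: commute)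
  have c8: "\<not> (E x c \<and> E y c \<and> E z a \<and> E z b)"
    using packs_2_0[of E x y c z a b W] no edges D by (auto simp: commute)
  have "int (nb E w T) + int (nb E x T) + int (nb E y T) + int (nb E z T) \<le> 8"
    unfolding T(1) int_nb_3[OF T(2)] using c0 c1 c2 c3 c4 c5 c6 c7 c8 by (smt (verit))
  then show ?thesis
    by linarith
qed

section \<open>A path on three vertices against one or two cycles\<close>

text \<open>A triangle disjoint from a path on four vertices. Found on a three-vertex path and a
  quadrilateral, it leads to the situation of \<open>packs_of_path\<close>.\<close>

definition tri_path :: "'a set \<Rightarrow> bool" where
  "tri_path W \<longleftrightarrow> (\<exists>a b c p q u v. E a b \<and> E b c \<and> E c a \<and> E p q \<and> E q u \<and> E u v
     \<and> distinct [a, b, c, p, q, u, v] \<and> {a, b, c, p, q, u, v} \<subseteq> W)"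

lemma tri_pathI:
  assumes "E a b" "E b c" "E c a" "E p q" "E q u" "E u v"
    "distinct [a, b, c, p, q, u, v]" "{a, b, c, p, q, u, v} \<subseteq> W"
  shows "tri_path W"
  unfolding tri_path_def using assms by (intro exI conjI)

text \<open>If \<open>x\<close> sees the consecutive vertices \<open>a, b\<close> and
  \<open>y\<close> sees \<open>c\<close>, then \<open>x a b\<close> is a triangle and
  \<open>d c y z\<close> a path. With five edges, one end has at least three neighbours on the
  quadrilateral, and its consecutive pairs leave the other end too few.\<close>

lemma cherry_quad_bound:
  assumes path: "E x z" "E z y" "distinct [x, z, y]" "{x, z, y} \<subseteq> W"
    and quad: "is_quad W E Q" "{x, z, y} \<inter> Q = {}"
    and no: "\<not> tri_path W"
  shows "nb E x Q + nb E y Q \<le> 4"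
proof -
  obtain a b c d where Q: "Q = {a, b, c, d}" "distinct [a, b, c, d]" "Q \<subseteq> W"
    "E a b" "E b c" "E c d" "E d a"
    using quad(1) by (elim is_quadE)
  have D: "distinct [x, z, y, a, b, c, d]" "{x, z, y, a, b, c, d} \<subseteq> W"
    using path(3,4) quad(2) Q(1-3) by auto
  note edges = path(1,2) Q(4-7)
  have c0: "\<not> (E x a \<and> E x b \<and> E y c)"
    using tri_pathI[of x a b d c y z W] no edges D by (auto simp: commute)
  have c1: "\<not> (E x a \<and> E x b \<and> E y d)"
    using tri_pathI[of x a b c d y z W] no edges D by (auto simp: commute)
  have c2: "\<not> (E x b \<and> E x c \<and> E y d)"
    using tri_pathI[of x b c a d y z W] no edges D by (auto simp: commute)
  have c3: "\<not> (E x b \<and> E x c \<and> E y a)"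
    using tri_pathI[of x b c d a y z W] no edges D by (auto simp: commute)
  have c4: "\<not> (E x c \<and> E x d \<and> E y a)"
    using tri_pathI[of x c d b a y z W] no edges D by (auto simp: commute)
  have c5: "\<not> (E x c \<and> E x d \<and> E y b)"
    using tri_pathI[of x c d a b y z W] no edges D by (auto simp: commute)
  have c6: "\<not> (E x d \<and> E x a \<and> E y b)"
    using tri_pathI[of x d a c b y z W] no edges D by (auto simp: commute)
  have c7: "\<not> (E x d \<and> E x a \<and> E y c)"
    using tri_pathI[of x d a b c y z W] no edges D by (auto simp: commute)
  have c8: "\<not> (E y a \<and> E y b \<and> E x c)"
    using tri_pathI[of y a b d c x z W] no edges D by (auto simp: commute)
  have c9: "\<not> (E y a \<and> E y b \<and> E x d)"
    using tri_pathI[of y a b c d x z W] no edges D by (auto simp: commute)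
  have c10: "\<not> (E y b \<and> E y c \<and> E x d)"
    using tri_pathI[of y b c a d x z W] no edges D by (auto simp: commute)
  have c11: "\<not> (E y b \<and> E y c \<and> E x a)"
    using tri_pathI[of y b c d a x z W] no edges D by (auto simp: commute)
  have c12: "\<not> (E y c \<and> E y d \<and> E x a)"
    using tri_pathI[of y c d b a x z W] no edges D by (auto simp: commute)
  have c13: "\<not> (E y c \<and> E y d \<and> E x b)"
    using tri_pathI[of y c d a b x z W] no edges D by (auto simp: commute)
  have c14: "\<not> (E y d \<and> E y a \<and> E x b)"
    using tri_pathI[of y d a c b x z W] no edges D by (auto simp: commute)
  have c15: "\<not> (E y d \<and> E y a \<and> E x c)"
    using tri_pathI[of y d a b c x z W] no edges D by (auto simp: commute)
  have "int (nb E x Q) + int (nb E y Q) \<le> 4"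
    unfolding Q(1) int_nb_4[OF Q(2)] using c0 c1 c2 c3 c4 c5 c6 c7 c8 c9 c10 c11 c12 c13 c14 c15 by (smt (verit))
  then show ?thesis
    by linarith
qed

text \<open>For each vertex \<open>a\<close> of \<open>T\<close>, the six possible edges split into
  \<open>xa, yb, yc\<close> and \<open>ya, xb, xc\<close>. At most one edge is missing, so one of
  these triples is complete, and an edge \<open>za\<close> would then give two disjoint
  triangles.\<close>

lemma cherry_heavy_triangle:
  assumes path: "E x z" "E z y" "distinct [x, z, y]" "{x, z, y} \<subseteq> W"
    and tri: "is_triangle W E T" "{x, z, y} \<inter> T = {}"
    and no: "\<not> packs E W 2 0"
    and heavy: "nb E x T + nb E y T \<ge> 5"
  shows "nb E z T = 0"
proof -
  obtain a b c where T: "T = {a, b, c}" "distinct [a, b, c]" "T \<subseteq> W" "E a b" "E b c" "E c a"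
    using tri(1) by (elim is_triangleE)
  have D: "distinct [x, z, y, a, b, c]" "{x, z, y, a, b, c} \<subseteq> W"
    using path(3,4) tri(2) T(1-3) by auto
  note edges = path(1,2) T(4-6)
  have c0: "\<not> (E x a \<and> E z a \<and> E y b \<and> E y c)"
    using packs_2_0[of E x z a y b c W] no edges D by (auto simp: commute)
  have c1: "\<not> (E x b \<and> E z b \<and> E y c \<and> E y a)"
    using packs_2_0[of E x z b y c a W] no edges D by (auto simp: commute)
  have c2: "\<not> (E x c \<and> E z c \<and> E y a \<and> E y b)"
    using packs_2_0[of E x z c y a b W] no edges D by (auto simp: commute)
  have c3: "\<not> (E y a \<and> E z a \<and> E x b \<and> E x c)"
    using packs_2_0[of E y z a x b c W] no edges D by (auto simp: commute)
  have c4: "\<not> (E y b \<and> E z b \<and> E x c \<and> E x a)"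
    using packs_2_0[of E y z b x c a W] no edges D by (auto simp: commute)
  have c5: "\<not> (E y c \<and> E z c \<and> E x a \<and> E x b)"
    using packs_2_0[of E y z c x a b W] no edges D by (auto simp: commute)
  have "int (nb E x T) + int (nb E y T) \<ge> 5"
    using heavy by linarith
  then have "int (nb E z T) = 0"
    unfolding T(1) int_nb_3[OF T(2)] using c0 c1 c2 c3 c4 c5 by (smt (verit))
  then show ?thesis
    by linarith
qed

text \<open>Each excluded pattern would turn the nine vertices into three triangles, for instance
  \<open>x z u\<close>, \<open>y a b\<close> and \<open>c v w\<close>. The weights are those needed
  in \<open>cherry_heavy_triangle_impossible\<close>.\<close>

lemma cherry_heavy_pair_bound:
  assumes core: "E x z" "E z y" "E a b" "E b c" "E c a" "E x a" "E x b" "E x c" "E y a" "E y b"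
      "distinct [x, z, y, a, b, c]" "{x, z, y, a, b, c} \<subseteq> W"
    and tri: "is_triangle W E T" "{x, z, y, a, b, c} \<inter> T = {}"
    and no: "\<not> packs E W 3 0"
  shows "nb E x T + nb E y T + 2 * nb E z T + 2 * nb E c T \<le> 12"
proof -
  obtain u v w where T: "T = {u, v, w}" "distinct [u, v, w]" "T \<subseteq> W" "E u v" "E v w" "E w u"
    using tri(1) by (elim is_triangleE)
  have D: "distinct [x, z, y, a, b, c, u, v, w]" "{x, z, y, a, b, c, u, v, w} \<subseteq> W"
    using core(11,12) tri(2) T(1-3) by auto
  note edges = core(1-10) T(4-6)
  have c0: "\<not> (E x u \<and> E z u \<and> E c v \<and> E c w)"
    using packs_3_0[of E x z u y a b c v w W] no edges D by (auto simp: commute)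
  have c1: "\<not> (E x u \<and> E c u \<and> E z v \<and> E z w)"
    using packs_3_0[of E x c u y a b z v w W] no edges D by (auto simp: commute)
  have c2: "\<not> (E x u \<and> E z u \<and> E y v \<and> E y w)"
    using packs_3_0[of E x z u y v w a b c W] no edges D by (auto simp: commute)
  have c3: "\<not> (E y u \<and> E z u \<and> E c v \<and> E c w)"
    using packs_3_0[of E x a b y z u c v w W] no edges D by (auto simp: commute)
  have c4: "\<not> (E y u \<and> E z u \<and> E x v \<and> E x w)"
    using packs_3_0[of E x v w y z u a b c W] no edges D by (auto simp: commute)
  have c5: "\<not> (E x v \<and> E z v \<and> E c w \<and> E c u)"
    using packs_3_0[of E x z v y a b c w u W] no edges D by (auto simp: commute)
  have c6: "\<not> (E x v \<and> E c v \<and> E z w \<and> E z u)"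
    using packs_3_0[of E x c v y a b z w u W] no edges D by (auto simp: commute)
  have c7: "\<not> (E x v \<and> E z v \<and> E y w \<and> E y u)"
    using packs_3_0[of E x z v y w u a b c W] no edges D by (auto simp: commute)
  have c8: "\<not> (E y v \<and> E z v \<and> E c w \<and> E c u)"
    using packs_3_0[of E x a b y z v c w u W] no edges D by (auto simp: commute)
  have c9: "\<not> (E y v \<and> E z v \<and> E x w \<and> E x u)"
    using packs_3_0[of E x w u y z v a b c W] no edges D by (auto simp: commute)
  have c10: "\<not> (E x w \<and> E z w \<and> E c u \<and> E c v)"
    using packs_3_0[of E x z w y a b c u v W] no edges D by (auto simp: commute)
  have c11: "\<not> (E x w \<and> E c w \<and> E z u \<and> E z v)"
    using packs_3_0[of E x c w y a b z u v W] no edges D by (auto simp: commute)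
  have c12: "\<not> (E x w \<and> E z w \<and> E y u \<and> E y v)"
    using packs_3_0[of E x z w y u v a b c W] no edges D by (auto simp: commute)
  have c13: "\<not> (E y w \<and> E z w \<and> E c u \<and> E c v)"
    using packs_3_0[of E x a b y z w c u v W] no edges D by (auto simp: commute)
  have c14: "\<not> (E y w \<and> E z w \<and> E x u \<and> E x v)"
    using packs_3_0[of E x u v y z w a b c W] no edges D by (auto simp: commute)
  have "int (nb E x T) + int (nb E y T) + 2 * int (nb E z T) + 2 * int (nb E c T) \<le> 12"
    unfolding T(1) int_nb_3[OF T(2)] using c0 c1 c2 c3 c4 c5 c6 c7 c8 c9 c10 c11 c12 c13 c14 by (smt (verit))
  then show ?thesis
    by linarith
qed

section \<open>A single vertex against triangles and quadrilaterals\<close>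

text \<open>Two neighbours \<open>p, q\<close> of \<open>d\<close> in the triangle
  \<open>p u q\<close> would give the quadrilateral \<open>d p u q\<close>.\<close>

lemma vertex_triangle_bound:
  assumes tri: "is_triangle W E T" "d \<notin> T" "d \<in> W" and no: "\<not> packs E W 0 1"
  shows "nb E d T \<le> 1"
proof -
  obtain a b c where T: "T = {a, b, c}" "distinct [a, b, c]" "T \<subseteq> W" "E a b" "E b c" "E c a"
    using tri(1) by (elim is_triangleE)
  have "\<not> (E d p \<and> E d q)" if "{p, q, u} = T" "E p u" "E u q" "distinct [p, q, u]" for p q u
    using packs_mono[OF packs_quad[of E d p u q], of W] no tri(2,3) T(3) that commute[of d q] by auto
  from this[of a b c] this[of b c a] this[of c a b] show ?thesis
    using T commute[of a b] commute[of b c] commute[of c a] by auto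
qed

text \<open>If \<open>d\<close> sees \<open>a\<close> and \<open>c\<close>, it can replace
  \<open>b\<close> in the quadrilateral, so \<open>b\<close> is not a common neighbour of
  \<open>y\<close> and \<open>z\<close>: otherwise \<open>b y x z\<close> is a second quadrilateral.
  Likewise for the other vertices. Thus \<open>y\<close> and \<open>z\<close> together send at most
  8, 6 or 4 edges when \<open>d\<close> sends at most 2, 3 or 4.\<close>

lemma vertex_triangle_quad_bound:
  assumes tri: "E x y" "E y z" "E z x" "distinct [d, x, y, z]" "{d, x, y, z} \<subseteq> W"
    and quad: "is_quad W E Q" "{d, x, y, z} \<inter> Q = {}"
    and no: "\<not> packs E W 0 2"
  shows "2 * nb E d Q + nb E y Q + nb E z Q \<le> 12"
proof -
  obtain a b c e where Q: "Q = {a, b, c, e}" "distinct [a, b, c, e]" "Q \<subseteq> W"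
    "E a b" "E b c" "E c e" "E e a"
    using quad(1) by (elim is_quadE)
  have D: "distinct [d, x, y, z, a, b, c, e]" "{d, x, y, z, a, b, c, e} \<subseteq> W"
    using tri(4,5) quad(2) Q(1-3) by auto
  note edges = tri(1-3) Q(4-7)
  have c0: "\<not> (E d a \<and> E d c \<and> E y b \<and> E z b)"
    using packs_0_2[of E d a e c b y x z W] no edges D by (auto simp: commute)
  have c1: "\<not> (E d a \<and> E d c \<and> E y e \<and> E z e)"
    using packs_0_2[of E d a b c e y x z W] no edges D by (auto simp: commute)
  have c2: "\<not> (E d b \<and> E d e \<and> E y c \<and> E z c)"
    using packs_0_2[of E d b a e c y x z W] no edges D by (auto simp: commute)
  have c3: "\<not> (E d b \<and> E d e \<and> E y a \<and> E z a)"
    using packs_0_2[of E d b c e a y x z W] no edges D by (auto simp: commute)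
  have "2 * int (nb E d Q) + int (nb E y Q) + int (nb E z Q) \<le> 12"
    unfolding Q(1) int_nb_4[OF Q(2)] using c0 c1 c2 c3 by (smt (verit))
  then show ?thesis
    by linarith
qed

text \<open>If \<open>d\<close> sees \<open>u\<close>, then \<open>yu, zv, zw\<close> are not all
  edges, since \<open>d x y u\<close> and \<open>z v w\<close> would be a quadrilateral and a
  triangle; the same holds with \<open>y\<close> and \<open>z\<close> exchanged. These two triples
  partition the six possible edges, so at most four are present.\<close>

lemma pendant_triangle_triangle_bound:
  assumes tri: "E x y" "E y z" "E z x" "E d x" "distinct [d, x, y, z]" "{d, x, y, z} \<subseteq> W"
    and tri': "is_triangle W E T" "{d, x, y, z} \<inter> T = {}"
    and no: "\<not> packs E W 1 1" and "nb E d T \<le> 1"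
  shows "2 * nb E d T + nb E y T + nb E z T \<le> 6"
proof -
  obtain u v w where T: "T = {u, v, w}" "distinct [u, v, w]" "T \<subseteq> W" "E u v" "E v w" "E w u"
    using tri'(1) by (elim is_triangleE)
  have D: "distinct [d, x, y, z, u, v, w]" "{d, x, y, z, u, v, w} \<subseteq> W"
    using tri(5,6) tri'(2) T(1-3) by auto
  note edges = tri(1-4) T(4-6)
  have c0: "\<not> (E d u \<and> E y u \<and> E z v \<and> E z w)"
    using packs_1_1[of E z v w d x y u W] no edges D by (auto simp: commute)
  have c1: "\<not> (E d v \<and> E y v \<and> E z w \<and> E z u)"
    using packs_1_1[of E z w u d x y v W] no edges D by (auto simp: commute)
  have c2: "\<not> (E d w \<and> E y w \<and> E z u \<and> E z v)"
    using packs_1_1[of E z u v d x y w W] no edges D by (auto simp: commute)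
  have c3: "\<not> (E d u \<and> E z u \<and> E y v \<and> E y w)"
    using packs_1_1[of E y v w d x z u W] no edges D by (auto simp: commute)
  have c4: "\<not> (E d v \<and> E z v \<and> E y w \<and> E y u)"
    using packs_1_1[of E y w u d x z v W] no edges D by (auto simp: commute)
  have c5: "\<not> (E d w \<and> E z w \<and> E y u \<and> E y v)"
    using packs_1_1[of E y u v d x z w W] no edges D by (auto simp: commute)
  have "int (nb E d T) \<le> 1"
    using assms(10) by linarith
  then have "2 * int (nb E d T) + int (nb E y T) + int (nb E z T) \<le> 6"
    unfolding T(1) int_nb_3[OF T(2)] using c0 c1 c2 c3 c4 c5 by (smt (verit))
  then show ?thesis
    by linarith
qed

end

subsection \<open>Counting over a packing\<close>

lemma family_restrict: "family E W TT QQ \<Longrightarrow> family E (\<Union>TT \<union> \<Union>QQ) TT QQ"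
  unfolding family_def is_triangle_iff[of W] is_triangle_iff[of "\<Union>TT \<union> \<Union>QQ"]
    is_quad_iff[of W] is_quad_iff[of "\<Union>TT \<union> \<Union>QQ"] by auto

lemma family_disjoint:
  assumes "family E W TT QQ" "C \<in> TT \<union> QQ" "D \<in> TT \<union> QQ" "C \<noteq> D"
  shows "C \<inter> D = {}"
  using assms pairwiseD[of disjnt "TT \<union> QQ" C D] by (simp add: family_def disjnt_def)

lemma family_disjoint_triangle_quad:
  assumes "family E W TT QQ" "T \<in> TT" "Q \<in> QQ"
  shows "T \<inter> Q = {}"
  using family_disjoint[OF assms(1), of T Q] family_disjoint_kinds[OF assms(1)] assms(2,3) by auto

text \<open>Set bookkeeping for \<open>packs_of_tri_path\<close>: \<open>t\<close> becomes the new
  triangle, \<open>p\<close> the vertex set of the path to be kept free.\<close>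

lemma Un_Diff_subset_Diff:
  assumes "t \<subseteq> Z \<union> Q" "S \<union> Z \<union> Q \<subseteq> V" "t \<inter> p = {}" "S \<inter> p = {}" "p \<subseteq> P \<union> A \<union> Q"
  shows "(V - P - A - Q) \<union> (S \<union> t) \<subseteq> V - p"
  using assms by blast

section \<open>Graphs satisfying the degree-sum condition\<close>

text \<open>The constant \<open>4 * (r + s)\<close> is n + r for n = 3r + 4s. The condition survives
  the addition of edges.\<close>

locale ore_graph =
  fixes V :: "'a set" and E :: "'a \<Rightarrow> 'a \<Rightarrow> bool" and r s :: nat
  assumes simple: "simple_graph V E"
    and card_V: "card V = 3 * r + 4 * s"
    and ore: "x \<in> V \<Longrightarrow> y \<in> V \<Longrightarrow> x \<noteq> y \<Longrightarrow> \<not> E x y \<Longrightarrow> 4 * (r + s) \<le> nb E x V + nb E y V"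

sublocale ore_graph \<subseteq> symmetric_relation E
  using simple by unfold_locales (auto simp: simple_graph_def)

context ore_graph
begin

lemma irrefl [simp]: "\<not> E x x"
  using simple by (simp add: simple_graph_def)

lemma finite_V: "finite V"
  using simple by (simp add: simple_graph_def)

lemma packs_of_triangles_and_vertex:
  assumes "1 \<le> s" "2 * s \<le> r + 2" and surplus: "packs E V (r + 1) (s - 1)"
  shows "packs E V r s"
proof (rule ccontr)
  assume no: "\<not> packs E V r s"
  obtain TT QQ where F0: "family E V TT QQ" and cards: "card TT = r + 1" "card QQ = s - 1"
    using surplus by (auto simp: packs_def)
  define W where "W = \<Union>TT \<union> \<Union>QQ"
  have F: "family E W TT QQ"
    unfolding W_def using F0 by (rule family_restrict)
  have fin: "finite TT" "finite QQ"
    using F by (auto simp: family_def)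
  have "W \<subseteq> V"
    unfolding W_def using family_memD(1)[OF F0] by blast
  have card_W: "card W = 3 * card TT + 4 * card QQ"
    unfolding W_def by (rule card_Union_family[OF F0])
  have "finite W"
    using \<open>W \<subseteq> V\<close> finite_V finite_subset by blast
  have "card (V - W) = 1"
    using card_W card_V cards \<open>1 \<le> s\<close> \<open>W \<subseteq> V\<close> \<open>finite W\<close> by (simp add: card_Diff_subset)
  then obtain d where d: "V - W = {d}"
    using card_1_singletonE by blast
  then have V: "V = W \<union> {d}" "{d} \<inter> W = {}"
    using \<open>W \<subseteq> V\<close> by auto
  \<comment> \<open>One triangle fewer and one quadrilateral more would give exactly
    \<open>r\<close> and \<open>s\<close>. The condition \<open>card A \<ge> 1\<close> makes the
    truncated subtraction genuine.\<close>
  have no_local: "\<not> packs E ({d} \<union> \<Union>A \<union> \<Union>B) (card A - 1) (card B + 1)"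
    if "A \<subseteq> TT" "B \<subseteq> QQ" "card A \<ge> 1" for A B
  proof
    assume "packs E ({d} \<union> \<Union>A \<union> \<Union>B) (card A - 1) (card B + 1)"
    moreover have "({d} \<union> \<Union>A \<union> \<Union>B) \<inter> (W - \<Union>A - \<Union>B) = {}"
      using V by auto
    ultimately have "packs E ((W - \<Union>A - \<Union>B) \<union> ({d} \<union> \<Union>A \<union> \<Union>B))
        (card TT - card A + (card A - 1)) (card QQ - card B + (card B + 1))"
      using family_replace[OF F that(1,2)] by blast
    moreover have "card TT - card A + (card A - 1) = r" "card QQ - card B + (card B + 1) = s"
      using card_mono[OF fin(1) that(1)] card_mono[OF fin(2) that(2)] that(3) cards \<open>1 \<le> s\<close> by auto
    moreover have "(W - \<Union>A - \<Union>B) \<union> ({d} \<union> \<Union>A \<union> \<Union>B) \<subseteq> V"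
      using V that family_memD(1)[OF F] by blast
    ultimately show False
      using no packs_mono by metis
  qed
  have tri: "is_triangle W E T" "d \<notin> T" if "T \<in> TT" for T
    using F that V family_memD(1)[OF F] by (auto simp: family_def)
  have quad: "is_quad W E Q" "d \<notin> Q" if "Q \<in> QQ" for Q
    using F that V family_memD(1)[OF F] by (auto simp: family_def)
  have dT: "nb E d T \<le> 1" if "T \<in> TT" for T
  proof (rule vertex_triangle_bound)
    show "\<not> packs E ({d} \<union> T) 0 1"
      using no_local[of "{T}" "{}"] that by simp
    show "is_triangle ({d} \<union> T) E T"
      using tri[OF that] is_triangle_iff[of W E T] is_triangle_iff[of "{d} \<union> T" E T] by blast
  qed (use tri[OF that] in auto)
  \<comment> \<open>A triangle containing a neighbour of \<open>d\<close> is preferred; an arbitrary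
    one is taken only if \<open>d\<close> sends no edge to any triangle.\<close>
  obtain T where T: "T \<in> TT" "nb E d T \<noteq> 0 \<or> (\<forall>T\<in>TT. nb E d T = 0)"
  proof (cases "\<exists>T\<in>TT. nb E d T \<noteq> 0")
    case True
    then show ?thesis
      using that by blast
  next
    case False
    moreover have "TT \<noteq> {}"
      using cards by auto
    ultimately show ?thesis
      using that by blast
  qed
  obtain x y z where T_eq: "T = {x, y, z}" and xyz: "distinct [x, y, z]" "E x y" "E y z" "E z x"
    and dyz: "\<not> E d y" "\<not> E d z" and dx: "E d x \<or> (\<forall>T\<in>TT. nb E d T = 0)"
  proof -
    obtain a b c where abc: "T = {a, b, c}" "distinct [a, b, c]" "E a b" "E b c" "E c a"
      using tri(1)[OF T(1)] by (elim is_triangleE)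
    have le: "int (nb E d T) \<le> 1"
      using dT[OF T(1)] by simp
    then consider "\<not> E d b" "\<not> E d c" | "\<not> E d c" "\<not> E d a" | "\<not> E d a" "\<not> E d b"
      unfolding abc(1) int_nb_3[OF abc(2)] by (auto split: if_splits)
    then show ?thesis
    proof cases
      case 1
      have "E d a \<or> (\<forall>T\<in>TT. nb E d T = 0)"
        using T(2) 1 abc by auto
      then show ?thesis
        using that[of a b c] 1 abc by auto
    next
      case 2
      have "E d b \<or> (\<forall>T\<in>TT. nb E d T = 0)"
        using T(2) 2 abc by auto
      then show ?thesis
        using that[of b c a] 2 abc by auto
    next
      case 3
      have "E d c \<or> (\<forall>T\<in>TT. nb E d T = 0)"
        using T(2) 3 abc by auto
      then show ?thesis
        using that[of c a b] 3 abc by auto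
    qed
  qed
  have in_V: "d \<in> V" "y \<in> V" "z \<in> V" and dxyz: "distinct [d, x, y, z]"
    using V tri[OF T(1)] T_eq family_memD(1)[OF F] T(1) xyz by auto
  \<comment> \<open>The weights add up the degree sums of the nonadjacent pairs \<open>d, y\<close>
    and \<open>d, z\<close>.\<close>
  define f where "f C = 2 * nb E d C + nb E y C + nb E z C" for C
  have "8 * (r + s) \<le> f V"
    using ore[of d y] ore[of d z] in_V dyz dxyz by (auto simp: f_def)
  also have "f V = f {d} + (\<Sum>C\<in>TT. f C) + (\<Sum>C\<in>QQ. f C)"
    using nb_family[OF F \<open>finite W\<close> card_W _ V(2)] V(1)
    by (simp add: f_def sum.distrib sum_distrib_left)
  also have "f {d} = 0"
    using dyz by (simp add: f_def commute[of y d] commute[of z d])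
  finally have total: "8 * (r + s) \<le> (\<Sum>C\<in>TT. f C) + (\<Sum>C\<in>QQ. f C)"
    by simp
  have "f Q \<le> 12" if "Q \<in> QQ" for Q
    unfolding f_def
  proof (rule vertex_triangle_quad_bound)
    show "\<not> packs E ({d} \<union> T \<union> Q) 0 2"
      using no_local[of "{T}" "{Q}"] that T(1) by (simp add: numeral_2_eq_2)
    show "is_quad ({d} \<union> T \<union> Q) E Q"
      using quad[OF that] is_quad_iff[of W E Q] is_quad_iff[of "{d} \<union> T \<union> Q" E Q] by blast
    have "T \<inter> Q = {}"
      using F T(1) that by (rule family_disjoint_triangle_quad)
    then show "{d, x, y, z} \<inter> Q = {}"
      using quad[OF that] T_eq by auto
  qed (use xyz dxyz T_eq in auto)
  then have QQ_sum: "(\<Sum>C\<in>QQ. f C) \<le> 12 * (s - 1)"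
    using sum_bounded_above[of QQ f 12] cards by simp
  have yz_le: "nb E y C \<le> 3" "nb E z C \<le> 3" if "C \<in> TT" for C
    using nb_le_card[of C E] is_triangleD[OF tri(1)[OF that]] by metis+
  have yz_T: "nb E y T = 2" "nb E z T = 2"
    using xyz by (auto simp: T_eq commute[of y x] commute[of z y] commute[of x z])
  have TT_sum: "(\<Sum>C\<in>TT. f C) \<le> 6 * (r + 1)"
  proof -
    have "f C \<le> 6" if C: "C \<in> TT" for C
    proof (cases "C = T \<or> (\<forall>T\<in>TT. nb E d T = 0)")
      case True
      then show ?thesis
        using yz_T yz_le[OF C] dT[OF T(1)] C by (auto simp: f_def)
    next
      case False
      then have "C \<noteq> T"
        by blast
      show ?thesis
        unfolding f_def
      proof (rule pendant_triangle_triangle_bound)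
        show "\<not> packs E ({d} \<union> T \<union> C) 1 1"
          using no_local[of "{T, C}" "{}"] C T(1) \<open>C \<noteq> T\<close> by (simp add: Un_assoc)
        show "is_triangle ({d} \<union> T \<union> C) E C"
          using tri[OF C] is_triangle_iff[of W E C] is_triangle_iff[of "{d} \<union> T \<union> C" E C] by blast
        have "T \<inter> C = {}"
          using family_disjoint[OF F, of T C] T(1) C \<open>C \<noteq> T\<close> by simp
        then show "{d, x, y, z} \<inter> C = {}"
          using tri[OF C] T_eq by auto
      qed (use xyz dxyz dx False T_eq dT[OF C] in auto)
    qed
    then show ?thesis
      using sum_bounded_above[of TT f 6] cards by simp
  qed
  \<comment> \<open>Now 8(r + s) is at most 6(r + 1) + 12(s - 1), that is, r is at most 2s -
    3.\<close>
  show False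
    using total QQ_sum TT_sum assms(1,2) by (cases s) simp_all
qed

lemma packs_of_path:
  assumes path: "E w x" "E x y" "E y z" "distinct [w, x, y, z]" "{w, x, y, z} \<subseteq> V"
    and "1 \<le> s" and rest: "packs E (V - {w, x, y, z}) r (s - 1)"
  shows "packs E V r s \<or> packs E V (r + 1) (s - 1)"
proof (rule ccontr)
  assume no: "\<not> (packs E V r s \<or> packs E V (r + 1) (s - 1))"
  define P W where "P = {w, x, y, z}" and "W = V - P"
  obtain TT QQ where F: "family E W TT QQ" and cards: "card TT = r" "card QQ = s - 1"
    using rest by (auto simp: packs_def W_def P_def)
  have fin: "finite TT" "finite QQ"
    using F by (auto simp: family_def)
  have P: "P \<subseteq> V" "finite P" "card P = 4"
    using path by (auto simp: P_def)
  then have V: "V = W \<union> P" "P \<inter> W = {}"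
    by (auto simp: W_def)
  have "finite W"
    using finite_V by (simp add: W_def)
  have card_W: "card W = 3 * card TT + 4 * card QQ"
    using P card_V cards \<open>1 \<le> s\<close> by (simp add: W_def card_Diff_subset)
  \<comment> \<open>Gaining a triangle while keeping the number of quadrilaterals would give
    \<open>r + 1\<close> triangles and \<open>s - 1\<close> quadrilaterals.\<close>
  have no_local: "\<not> packs E (P \<union> \<Union>A \<union> \<Union>B) (card A + 1) (card B)"
    if "A \<subseteq> TT" "B \<subseteq> QQ" for A B
  proof
    assume "packs E (P \<union> \<Union>A \<union> \<Union>B) (card A + 1) (card B)"
    moreover have "(P \<union> \<Union>A \<union> \<Union>B) \<inter> (W - \<Union>A - \<Union>B) = {}"
      using V by auto
    ultimately have "packs E ((W - \<Union>A - \<Union>B) \<union> (P \<union> \<Union>A \<union> \<Union>B))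
        (card TT - card A + (card A + 1)) (card QQ - card B + card B)"
      using family_replace[OF F that(1,2)] by blast
    moreover have "card TT - card A + (card A + 1) = r + 1" "card QQ - card B + card B = s - 1"
      using card_mono[OF fin(1) that(1)] card_mono[OF fin(2) that(2)] cards by auto
    moreover have "(W - \<Union>A - \<Union>B) \<union> (P \<union> \<Union>A \<union> \<Union>B) \<subseteq> V"
      using V that family_memD(1)[OF F] by blast
    ultimately show False
      using no packs_mono by metis
  qed
  have no_P: "\<not> packs E P 1 0"
    using no_local[of "{}" "{}"] by simp
  have nonadj: "\<not> E w y" "\<not> E x z"
    using packs_mono[OF packs_triangle[of E w x y], of P] commute[of w y]
      packs_mono[OF packs_triangle[of E x y z], of P] commute[of x z] path no_P
    by (auto simp: P_def)
  define f where "f C = nb E w C + nb E x C + nb E y C + nb E z C" for C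
  have "8 * (r + s) \<le> f V"
    using ore[of w y] ore[of x z] path nonadj by (auto simp: f_def)
  also have "f V = f P + (\<Sum>C\<in>TT. f C) + (\<Sum>C\<in>QQ. f C)"
    using nb_family[OF F \<open>finite W\<close> card_W P(2) V(2)] V(1)
    by (simp add: f_def sum.distrib)
  finally have total: "8 * (r + s) \<le> f P + (\<Sum>C\<in>TT. f C) + (\<Sum>C\<in>QQ. f C)" .
  have "\<not> E w z"
  proof
    assume "E w z"
    then have "packs E P 0 1"
      using packs_quad[of E w x y z] path commute[of w z] by (simp add: P_def)
    moreover have "packs E W r (s - 1)"
      using F cards unfolding packs_def by blast
    ultimately have "packs E V (r + 0) (s - 1 + 1)"
      using packs_Un[of E W r "s - 1" P 0 1] V by (simp add: Int_commute)
    then show False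
      using no \<open>1 \<le> s\<close> by simp
  qed
  \<comment> \<open>No chord is left, so the degrees inside \<open>P\<close> are 1, 2, 2, 1. The
    total is then at most 6 + 8r + 8(s - 1), which is 2 short of 8(r + s).\<close>
  then have P_sum: "f P \<le> 6"
    using path nonadj commute[of w x] commute[of x y] commute[of y z] commute[of w y]
      commute[of x z] commute[of z w]
    by (auto simp: f_def P_def)
  have "f C \<le> 8" if "C \<in> TT" for C
    unfolding f_def
  proof (rule path_triangle_bound[OF path(1-4)])
    have "is_triangle W E C"
      using F that by (simp add: family_def)
    then show "is_triangle (P \<union> C) E C" "{w, x, y, z} \<inter> C = {}"
      using is_triangle_iff[of W E C] is_triangle_iff[of "P \<union> C" E C] V unfolding P_def by blast+
    show "\<not> packs E (P \<union> C) 2 0"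
      using no_local[of "{C}" "{}"] that by (simp add: numeral_2_eq_2)
  qed (auto simp: P_def)
  then have TT_sum: "(\<Sum>C\<in>TT. f C) \<le> 8 * r"
    using sum_bounded_above[of TT f 8] cards by simp
  have "f C \<le> 8" if "C \<in> QQ" for C
    unfolding f_def
  proof (rule path_quad_bound[OF path(1-4)])
    have "is_quad W E C"
      using F that by (simp add: family_def)
    then show "is_quad (P \<union> C) E C" "{w, x, y, z} \<inter> C = {}"
      using is_quad_iff[of W E C] is_quad_iff[of "P \<union> C" E C] V unfolding P_def by blast+
    show "\<not> packs E (P \<union> C) 1 1"
      using no_local[of "{}" "{C}"] that by simp
  qed (auto simp: P_def)
  then have QQ_sum: "(\<Sum>C\<in>QQ. f C) \<le> 8 * (s - 1)"
    using sum_bounded_above[of QQ f 8] cards by simp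
  show False
    using total P_sum TT_sum QQ_sum \<open>1 \<le> s\<close> by (cases s) simp_all
qed

text \<open>The triangles in \<open>A\<close> are traded for equally many in \<open>S\<close>,
  leaving the vertices \<open>Z\<close>. The triangle and path found in \<open>Z\<close> and
  \<open>Q\<close> then replace \<open>Q\<close>, and \<open>packs_of_path\<close> takes over. It is
  applied with \<open>A\<close> empty and \<open>Z = P\<close>, and with \<open>A\<close> a single
  triangle.\<close>

lemma packs_of_tri_path:
  assumes F: "family E (V - P) TT QQ" and cards: "card TT = r - 1" "card QQ = s"
    and "1 \<le> r" "1 \<le> s" "P \<subseteq> V" "A \<subseteq> TT" "Q \<in> QQ"
    and S: "packs E S (card A) 0" "S \<inter> Z = {}" "S \<union> Z \<subseteq> P \<union> \<Union>A"
    and tp: "tri_path (Z \<union> Q)"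
  shows "packs E V r s \<or> packs E V (r + 1) (s - 1)"
proof -
  have fin: "finite TT" "finite QQ"
    using F by (auto simp: family_def)
  obtain a b c p q u v where tri: "E a b" "E b c" "E c a" and path: "E p q" "E q u" "E u v"
    and dist: "distinct [a, b, c, p, q, u, v]" and sub: "{a, b, c, p, q, u, v} \<subseteq> Z \<union> Q"
    using tp unfolding tri_path_def by (elim exE conjE) (rule that)
  have "T \<inter> Q = {}" if "T \<in> TT" for T
    using F that \<open>Q \<in> QQ\<close> by (rule family_disjoint_triangle_quad)
  moreover have "P \<inter> Q = {}" "Q \<subseteq> V - P"
    using family_memD(1)[OF F] \<open>Q \<in> QQ\<close> by blast+
  ultimately have "S \<inter> Q = {}"
    using S(3) \<open>A \<subseteq> TT\<close> by blast
  have "\<Union>A \<subseteq> V - P"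
    using family_memD(1)[OF F] \<open>A \<subseteq> TT\<close> by blast
  have abc: "{a, b, c} \<subseteq> Z \<union> Q" and pquv: "{p, q, u, v} \<subseteq> Z \<union> Q"
    using sub by simp_all
  have "S \<inter> (Z \<union> Q) = {}"
    using S(2) \<open>S \<inter> Q = {}\<close> by blast
  then have S_disj: "S \<inter> {a, b, c} = {}" "S \<inter> {p, q, u, v} = {}"
    using abc pquv by (meson disjoint_iff subsetD)+
  have SZQ: "S \<union> Z \<union> Q \<subseteq> V"
    using S(3) \<open>\<Union>A \<subseteq> V - P\<close> \<open>Q \<subseteq> V - P\<close> \<open>P \<subseteq> V\<close> by blast
  then have ZQ: "Z \<union> Q \<subseteq> V"
    by blast
  have "packs E {a, b, c} 1 0"
    using tri dist by (intro packs_triangle) simp_all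
  then have "packs E (S \<union> {a, b, c}) (card A + 1) (0 + 0)"
    using S(1) S_disj(1) by (intro packs_Un)
  moreover have "(S \<union> {a, b, c}) \<inter> (V - P - \<Union>A - \<Union>{Q}) = {}"
    using S(3) sub by auto
  ultimately have "packs E ((V - P - \<Union>A - \<Union>{Q}) \<union> (S \<union> {a, b, c}))
      (card TT - card A + (card A + 1)) (card QQ - card {Q} + (0 + 0))"
    using \<open>A \<subseteq> TT\<close> \<open>Q \<in> QQ\<close> by (intro family_replace[OF F]) auto
  moreover have "card TT - card A + (card A + 1) = r" "card QQ - card {Q} + (0 + 0) = s - 1"
    using card_mono[OF fin(1) \<open>A \<subseteq> TT\<close>] cards \<open>1 \<le> r\<close> by auto
  moreover have "(V - P - \<Union>A - \<Union>{Q}) \<union> (S \<union> {a, b, c}) \<subseteq> V - {p, q, u, v}"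
  proof -
    have "{a, b, c} \<inter> {p, q, u, v} = {}"
      using dist by simp
    moreover have "{p, q, u, v} \<subseteq> P \<union> \<Union>A \<union> Q"
      using pquv S(3) by (meson Un_mono le_sup_iff order_refl order_trans)
    ultimately show ?thesis
      using abc SZQ S_disj(2) Un_Diff_subset_Diff[of "{a, b, c}" "Z" Q S V "{p, q, u, v}" P "\<Union>A"] by simp
  qed
  ultimately have "packs E (V - {p, q, u, v}) r (s - 1)"
    using packs_mono by metis
  moreover have "{p, q, u, v} \<subseteq> V"
    using pquv ZQ by (rule order_trans)
  ultimately show ?thesis
    using packs_of_path[OF path _ _ \<open>1 \<le> s\<close>] dist by auto
qed

lemma no_local_packing:
  assumes F: "family E (V - P) TT QQ" and cards: "card TT = r - 1" "card QQ = s"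
    and "1 \<le> r" "P \<subseteq> V" "A \<subseteq> TT" and no: "\<not> packs E V r s"
  shows "\<not> packs E (P \<union> \<Union>A) (card A + 1) 0"
proof
  assume "packs E (P \<union> \<Union>A) (card A + 1) 0"
  moreover have "(P \<union> \<Union>A) \<inter> (V - P - \<Union>A) = {}"
    by auto
  ultimately have "packs E ((V - P - \<Union>A) \<union> (P \<union> \<Union>A)) (card TT - card A + (card A + 1)) (card QQ)"
    using family_replace[OF F \<open>A \<subseteq> TT\<close> empty_subsetI, of "P \<union> \<Union>A" "card A + 1" 0] by simp
  moreover have "finite TT"
    using F by (simp add: family_def)
  then have "card TT - card A + (card A + 1) = r"
    using card_mono[OF _ \<open>A \<subseteq> TT\<close>] cards \<open>1 \<le> r\<close> by auto
  moreover have "(V - P - \<Union>A) \<union> (P \<union> \<Union>A) \<subseteq> V"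
    using \<open>P \<subseteq> V\<close> \<open>A \<subseteq> TT\<close> family_memD(1)[OF F] by blast
  ultimately show False
    using no cards packs_mono by metis
qed

text \<open>The nonadjacent pair \<open>x, y\<close> counted once and \<open>z, c\<close> counted
  twice require 12(r + s). The three-vertex path and the triangle \<open>a b c\<close> contribute at
  most 10 each and every other cycle at most 12, which is 4 too few.\<close>

lemma cherry_heavy_triangle_impossible:
  assumes F: "family E (V - {x, z, y}) TT QQ" and cards: "card TT = r - 1" "card QQ = s"
    and "1 \<le> r" "1 \<le> s"
    and cherry: "E x z" "E z y" "\<not> E x y" "distinct [x, z, y]" "{x, z, y} \<subseteq> V"
    and T: "{a, b, c} \<in> TT" "distinct [a, b, c]" "E a b" "E b c" "E c a"
    and heavy: "E x a" "E x b" "E x c" "E y a" "E y b"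
    and no: "\<not> packs E V r s" "\<not> packs E V (r + 1) (s - 1)"
  shows False
proof -
  define P W where "P = {x, z, y}" and "W = V - P"
  have F: "family E W TT QQ"
    using F by (simp add: W_def P_def)
  note no_tri_path = packs_of_tri_path[OF F[unfolded W_def] cards \<open>1 \<le> r\<close> \<open>1 \<le> s\<close>]
  note no_local = no_local_packing[OF F[unfolded W_def] cards \<open>1 \<le> r\<close> _ _ no(1)]
  have fin: "finite TT" "finite QQ"
    using F by (auto simp: family_def)
  have P: "P \<subseteq> V" "finite P" "card P = 3"
    using cherry by (auto simp: P_def)
  then have V: "V = W \<union> P" "P \<inter> W = {}"
    by (auto simp: W_def)
  have "finite W"
    using finite_V by (simp add: W_def)
  have card_W: "card W = 3 * card TT + 4 * card QQ"
    using P card_V cards \<open>1 \<le> r\<close> by (simp add: W_def card_Diff_subset)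
  have abc_W: "{a, b, c} \<subseteq> W"
    using family_memD(1)[OF F] T(1) by blast
  then have dist: "distinct [x, z, y, a, b, c]"
    using cherry T V(2) by (auto simp: P_def)
  have z_T: "nb E z {a, b, c} = 0"
  proof (rule cherry_heavy_triangle[OF cherry(1,2,4)])
    show "\<not> packs E (P \<union> {a, b, c}) 2 0"
      using no_local[of "{{a, b, c}}"] P T(1) by (simp add: numeral_2_eq_2)
    show "is_triangle (P \<union> {a, b, c}) E {a, b, c}"
      using T unfolding is_triangle_def by (intro exI[of _ a] exI[of _ b] exI[of _ c]) simp
    show "5 \<le> nb E x {a, b, c} + nb E y {a, b, c}"
      using T heavy by simp
  qed (use dist in \<open>auto simp: P_def\<close>)
  then have "\<not> E z a" "\<not> E z b" "\<not> E z c"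
    using T(2) by auto
  \<comment> \<open>A triangle heavy for \<open>x, y\<close> misses \<open>z\<close>, and one heavy for \<open>z, c\<close> essentially misses
    \<open>x, y\<close>; with these weights both give at most 12.\<close>
  define f where "f C = nb E x C + nb E y C + 2 * nb E z C + 2 * nb E c C" for C
  have "12 * (r + s) \<le> f V"
    using ore[of x y] ore[of z c] cherry \<open>\<not> E z c\<close> dist V abc_W by (auto simp: f_def)
  also have "f V = f P + (\<Sum>C\<in>TT. f C) + (\<Sum>C\<in>QQ. f C)"
    using nb_family[OF F \<open>finite W\<close> card_W P(2) V(2)] V(1)
    by (simp add: f_def sum.distrib sum_distrib_left)
  also have "(\<Sum>C\<in>TT. f C) = f {a, b, c} + (\<Sum>C\<in>TT - {{a, b, c}}. f C)"
    using fin T(1) by (intro sum.remove)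
  finally have total: "12 * (r + s) \<le>
      f P + f {a, b, c} + (\<Sum>C\<in>TT - {{a, b, c}}. f C) + (\<Sum>C\<in>QQ. f C)"
    by simp
  have P_sum: "f P \<le> 10"
    using cherry \<open>\<not> E z c\<close> commute[of x z] commute[of z y] commute[of x y] commute[of c z]
    by (auto simp: f_def P_def)
  have T_sum: "f {a, b, c} \<le> 10"
    using z_T T(2) by (auto simp: f_def)
  have "f C \<le> 12" if C: "C \<in> TT - {{a, b, c}}" for C
    unfolding f_def
  proof (rule cherry_heavy_pair_bound[OF cherry(1,2) T(3-5) heavy dist])
    have "is_triangle W E C"
      using F C by (simp add: family_def)
    then show "is_triangle (P \<union> {a, b, c} \<union> C) E C"
      using is_triangle_iff[of W E C] is_triangle_iff[of "P \<union> {a, b, c} \<union> C" E C] by blast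
    have "C \<subseteq> W"
      using family_memD(1)[OF F] C by blast
    moreover have "{a, b, c} \<inter> C = {}"
      using family_disjoint[OF F, of "{a, b, c}" C] T(1) C by auto
    ultimately show "{x, z, y, a, b, c} \<inter> C = {}"
      using V(2) by (auto simp: P_def)
    have "{a, b, c} \<noteq> C"
      using C by blast
    then have "card {{a, b, c}, C} = 2"
      by simp
    then show "\<not> packs E (P \<union> {a, b, c} \<union> C) 3 0"
      using no_local[of "{{a, b, c}, C}"] P T(1) C by (simp add: Un_assoc)
  qed (auto simp: P_def)
  moreover have "card (TT - {{a, b, c}}) = r - 2"
    using T(1) fin cards by simp
  ultimately have TT_sum: "(\<Sum>C\<in>TT - {{a, b, c}}. f C) \<le> 12 * (r - 2)"
    using sum_bounded_above[of "TT - {{a, b, c}}" f 12] by simp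
  have "f Q \<le> 12" if Q: "Q \<in> QQ" for Q
  proof -
    have quad: "is_quad W E Q"
      using F Q by (simp add: family_def)
    have "{a, b, c} \<inter> Q = {}"
      using F T(1) Q by (rule family_disjoint_triangle_quad)
    moreover have "P \<inter> Q = {}"
      using family_memD(1)[OF F] Q V(2) by blast
    ultimately have disj: "{x, z, y, a, b, c} \<inter> Q = {}"
      by (auto simp: P_def)
    have "nb E x Q + nb E y Q \<le> 4"
    proof (rule cherry_quad_bound[OF cherry(1,2,4)])
      show "is_quad (P \<union> Q) E Q"
        using quad is_quad_iff[of W E Q] is_quad_iff[of "P \<union> Q" E Q] by blast
      show "\<not> tri_path (P \<union> Q)"
        using no_tri_path[OF P(1) _ Q, of "{}" "{}" P] no packs_0[of E "{}"] by auto
    qed (use disj in \<open>auto simp: P_def\<close>)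
    \<comment> \<open>Trading \<open>a b c\<close> for the triangle \<open>y a b\<close> leaves the
      path \<open>z x c\<close> with centre \<open>x\<close>, to which the same bound
      applies.\<close>
    moreover have "nb E z Q + nb E c Q \<le> 4"
    proof (rule cherry_quad_bound[of z x c])
      show "is_quad ({z, x, c} \<union> Q) E Q"
        using quad is_quad_iff[of W E Q] is_quad_iff[of "{z, x, c} \<union> Q" E Q] by blast
      have "packs E {y, a, b} (card {{a, b, c}}) 0"
        using packs_triangle[of E y a b] T heavy dist commute[of b y] by auto
      then show "\<not> tri_path ({z, x, c} \<union> Q)"
        using no_tri_path[OF P(1) _ Q, of "{{a, b, c}}" "{y, a, b}" "{z, x, c}"] no T(1) dist
        by (auto simp: P_def)
    qed (use disj dist cherry heavy commute[of x z] in auto)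
    ultimately show ?thesis
      by (simp add: f_def)
  qed
  then have QQ_sum: "(\<Sum>C\<in>QQ. f C) \<le> 12 * s"
    using sum_bounded_above[of QQ f 12] cards by simp
  have "card TT > 0"
    using T(1) fin by (auto simp: card_gt_0_iff)
  \<comment> \<open>This makes the truncated \<open>r - 2\<close> in \<open>TT_sum\<close> a true
    difference.\<close>
  then have "r \<ge> 2"
    using cards by simp
  then show False
    using total P_sum T_sum TT_sum QQ_sum by simp
qed

lemma packs_of_cherry:
  assumes cherry: "E x z" "E z y" "distinct [x, z, y]" "{x, z, y} \<subseteq> V"
    and "1 \<le> r" "1 \<le> s" and rest: "packs E (V - {x, z, y}) (r - 1) s"
  shows "packs E V r s \<or> packs E V (r + 1) (s - 1)"
proof (rule ccontr)
  assume "\<not> ?thesis"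
  then have no: "\<not> packs E V r s" "\<not> packs E V (r + 1) (s - 1)"
    by blast+
  define P W where "P = {x, z, y}" and "W = V - P"
  obtain TT QQ where F: "family E W TT QQ" and cards: "card TT = r - 1" "card QQ = s"
    using rest by (auto simp: packs_def W_def P_def)
  note no_tri_path = packs_of_tri_path[OF F[unfolded W_def] cards \<open>1 \<le> r\<close> \<open>1 \<le> s\<close>]
  note no_local = no_local_packing[OF F[unfolded W_def] cards \<open>1 \<le> r\<close> _ _ no(1)]
  have P: "P \<subseteq> V" "finite P" "card P = 3"
    using cherry by (auto simp: P_def)
  then have V: "V = W \<union> P" "P \<inter> W = {}"
    by (auto simp: W_def)
  have "finite W"
    using finite_V by (simp add: W_def)
  have card_W: "card W = 3 * card TT + 4 * card QQ"
    using P card_V cards \<open>1 \<le> r\<close> by (simp add: W_def card_Diff_subset)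
  have "\<not> E x y"
    using no_local[of "{}"] packs_triangle[of E x z y] cherry P(1) commute[of x y]
    by (auto simp: P_def)
  define f where "f C = nb E x C + nb E y C" for C
  have "4 * (r + s) \<le> f V"
    using ore[of x y] cherry \<open>\<not> E x y\<close> by (auto simp: f_def)
  also have "f V = f P + (\<Sum>C\<in>TT. f C) + (\<Sum>C\<in>QQ. f C)"
    using nb_family[OF F \<open>finite W\<close> card_W P(2) V(2)] V(1)
    by (simp add: f_def sum.distrib)
  also have "f P = 2"
    using cherry \<open>\<not> E x y\<close> commute[of y z] commute[of x y] by (auto simp: f_def P_def)
  finally have total: "4 * (r + s) \<le> 2 + (\<Sum>C\<in>TT. f C) + (\<Sum>C\<in>QQ. f C)" .
  have "f Q \<le> 4" if Q: "Q \<in> QQ" for Q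
    unfolding f_def
  proof (rule cherry_quad_bound[OF cherry(1-3)])
    have "is_quad W E Q"
      using F Q by (simp add: family_def)
    then show "is_quad (P \<union> Q) E Q" "{x, z, y} \<inter> Q = {}"
      using is_quad_iff[of W E Q] is_quad_iff[of "P \<union> Q" E Q] V(2) unfolding P_def by blast+
    show "\<not> tri_path (P \<union> Q)"
      using no_tri_path[OF P(1) _ Q, of "{}" "{}" P] no packs_0[of E "{}"] by auto
  qed (auto simp: P_def)
  then have "(\<Sum>C\<in>QQ. f C) \<le> 4 * s"
    using sum_bounded_above[of QQ f 4] cards by simp
  \<comment> \<open>At least 4r - 2 edges must go to the r - 1 triangles, so one of them receives
    five.\<close>
  then have "\<not> (\<Sum>C\<in>TT. f C) \<le> 4 * (r - 1)"
    using total \<open>1 \<le> r\<close> by (cases r) simp_all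
  then obtain T where T: "T \<in> TT" "f T \<ge> 5"
    using sum_bounded_above[of TT f 4] cards by fastforce
  have "is_triangle W E T"
    using F T(1) by (simp add: family_def)
  then obtain a b c where abc: "T = {a, b, c}" "distinct [a, b, c]" "E a b" "E b c" "E c a"
    by (elim is_triangleE)
  have F': "family E (V - {x, z, y}) TT QQ" "family E (V - {y, z, x}) TT QQ"
    using F by (simp_all add: W_def P_def insert_commute)
  note impossible_x = cherry_heavy_triangle_impossible[OF F'(1) cards \<open>1 \<le> r\<close> \<open>1 \<le> s\<close>
      cherry(1,2) _ _ _ _ _ _ _ _ _ _ _ _ _ no]
  note impossible_y = cherry_heavy_triangle_impossible[OF F'(2) cards \<open>1 \<le> r\<close> \<open>1 \<le> s\<close>
      _ _ _ _ _ _ _ _ _ _ _ _ _ _ _ no]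
  have perms: "{a, b, c} = {b, c, a}" "{a, b, c} = {c, a, b}"
    by auto
  \<comment> \<open>At most one of the six edges is missing, so one of \<open>x, y\<close> sees all
    of \<open>T\<close> and the other at least two of its vertices. \<open>core\<close> and
    \<open>core'\<close> treat the two roles, and the rotations of \<open>T\<close> put the possibly
    missing edge last.\<close>
  have core: False if "E x p" "E x q" "E x t" "E y p" "E y q" "{p, q, t} = T" "distinct [p, q, t]"
      "E p q" "E q t" "E t p" for p q t
    using impossible_x[of p q t] that T(1) \<open>\<not> E x y\<close> cherry by auto
  have core': False if "E y p" "E y q" "E y t" "E x p" "E x q" "{p, q, t} = T" "distinct [p, q, t]"
      "E p q" "E q t" "E t p" for p q t
    using impossible_y[of p q t] that T(1) \<open>\<not> E x y\<close> cherry commute[of x z] commute[of z y]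
      commute[of x y] by auto
  have "nb E x T + nb E y T \<ge> 5"
    using T(2) by (simp add: f_def)
  then have "int (nb E x T) + int (nb E y T) \<ge> 5"
    by linarith
  then show False
    using core[of a b c] core[of b c a] core[of c a b] core'[of a b c] core'[of b c a] core'[of c a b]
      abc perms unfolding abc(1) int_nb_3[OF abc(2)] by (auto split: if_splits)
qed

end
subsection \<open>Adding an edge\<close>

text \<open>Arbitrary triples, then quadruples, are cut off one at a time. This is the base case of
  the edge-adding argument.\<close>

lemma packs_complete:
  assumes "finite W" "card W = 3 * r + 4 * s" "\<And>u v. u \<in> W \<Longrightarrow> v \<in> W \<Longrightarrow> u \<noteq> v \<Longrightarrow> E u v"
  shows "packs E W r s"
  using assms
proof (induction "r + s" arbitrary: W r s)
  case 0
  then show ?case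
    by (simp add: packs_0)
next
  case (Suc n)
  define k where "k = (if r > 0 then 3 else 4 :: nat)"
  have "k \<le> card W"
    using Suc.prems(2) Suc.hyps(2) by (auto simp: k_def)
  then obtain S where S: "S \<subseteq> W" "card S = k" "finite S"
    using obtain_subset_with_card_n by metis
  obtain xs where xs: "set xs = S" "distinct xs" "length xs = k"
    using finite_distinct_list[OF S(3)] S(2) distinct_card by metis
  have card_rest: "card (W - S) = card W - k"
    using S by (simp add: card_Diff_subset)
  show ?case
  proof (cases "r > 0")
    case True
    then obtain a b c where abc: "xs = [a, b, c]"
      using xs(3) by (auto simp: k_def numeral_3_eq_3 length_Suc_conv)
    have "packs E (W - S) (r - 1) s"
      using Suc.hyps(2) Suc.prems True card_rest by (intro Suc.hyps(1)) (auto simp: k_def)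
    moreover have "packs E S 1 0"
      unfolding xs(1)[symmetric] abc
      using packs_triangle[of E a b c] xs S(1) Suc.prems(3) by (auto simp: abc)
    ultimately have "packs E (W - S \<union> S) (r - 1 + 1) (s + 0)"
      by (rule packs_Un) blast
    then show ?thesis
      using True S(1) by (simp add: Un_absorb2)
  next
    case False
    then obtain a b c d where abcd: "xs = [a, b, c, d]"
      using xs(3) by (auto simp: k_def numeral_eq_Suc length_Suc_conv)
    have "s > 0"
      using Suc.hyps(2) False by simp
    then have "packs E (W - S) r (s - 1)"
      using Suc.hyps(2) Suc.prems False card_rest by (intro Suc.hyps(1)) (auto simp: k_def)
    moreover have "packs E S 0 1"
      unfolding xs(1)[symmetric] abcd
      using packs_quad[of E a b c d] xs S(1) Suc.prems(3) by (auto simp: abcd)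
    ultimately have "packs E (W - S \<union> S) (r + 0) (s - 1 + 1)"
      by (rule packs_Un) blast
    then show ?thesis
      using \<open>s > 0\<close> S(1) by (simp add: Un_absorb2)
  qed
qed

definition add_edge :: "'a \<Rightarrow> 'a \<Rightarrow> ('a \<Rightarrow> 'a \<Rightarrow> bool) \<Rightarrow> 'a \<Rightarrow> 'a \<Rightarrow> bool" where
  "add_edge u v E = (\<lambda>p q. E p q \<or> {p, q} = {u, v})"

lemma is_triangle_add_edgeD:
  assumes "is_triangle W (add_edge u v E) T" "\<not> {u, v} \<subseteq> T"
  shows "is_triangle W E T"
proof -
  obtain a b c where T: "T = {a, b, c}" "distinct [a, b, c]" "T \<subseteq> W"
    "add_edge u v E a b" "add_edge u v E b c" "add_edge u v E c a"
    using assms(1) by (elim is_triangleE)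
  have "E p q" if "add_edge u v E p q" "p \<in> T" "q \<in> T" for p q
    using that assms(2) by (auto simp: add_edge_def doubleton_eq_iff)
  then have "E a b" "E b c" "E c a"
    using T by blast+
  then show ?thesis
    using T unfolding is_triangle_def by (intro exI[of _ a] exI[of _ b] exI[of _ c]) simp
qed

lemma is_quad_add_edgeD:
  assumes "is_quad W (add_edge u v E) Q" "\<not> {u, v} \<subseteq> Q"
  shows "is_quad W E Q"
proof -
  obtain a b c d where Q: "Q = {a, b, c, d}" "distinct [a, b, c, d]" "Q \<subseteq> W"
    "add_edge u v E a b" "add_edge u v E b c" "add_edge u v E c d" "add_edge u v E d a"
    using assms(1) by (elim is_quadE)
  have E: "E p q" if "add_edge u v E p q" "p \<in> Q" "q \<in> Q" for p q
    using that assms(2) by (auto simp: add_edge_def doubleton_eq_iff)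
  have "E a b" "E b c" "E c d" "E d a"
    using E[OF Q(4)] E[OF Q(5)] E[OF Q(6)] E[OF Q(7)] Q(1) by simp_all
  then show ?thesis
    using Q unfolding is_quad_def by (intro exI[of _ a] exI[of _ b] exI[of _ c] exI[of _ d]) simp
qed

lemma packs_add_edgeD:
  assumes "packs (add_edge u v E) W r s" "\<not> {u, v} \<subseteq> W"
  shows "packs E W r s"
proof -
  obtain TT QQ where F: "family (add_edge u v E) W TT QQ" "card TT = r" "card QQ = s"
    using assms(1) by (auto simp: packs_def)
  have "\<not> {u, v} \<subseteq> C" if "C \<in> TT \<union> QQ" for C
    using family_memD(1)[OF F(1) that] assms(2) by blast
  then have "family E W TT QQ"
    using F(1) is_triangle_add_edgeD[of W u v E] is_quad_add_edgeD[of W u v E]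
    unfolding family_def by simp
  then show ?thesis
    using F unfolding packs_def by blast
qed

text \<open>Both edges at the third vertex of \<open>T\<close> differ from \<open>uv\<close>, so
  they belong to \<open>E\<close>.\<close>

lemma triangle_add_edge_cherry:
  assumes "is_triangle W (add_edge u v E) T" "{u, v} \<subseteq> T" "u \<noteq> v"
    and sym: "\<And>x y. E x y \<longleftrightarrow> E y x"
  obtains (cherry) p where "T = {u, p, v}" "distinct [u, p, v]" "E u p" "E p v"
proof -
  obtain a b c where T: "T = {a, b, c}" "distinct [a, b, c]"
    and e: "add_edge u v E a b" "add_edge u v E b c" "add_edge u v E c a"
    using assms(1) by (elim is_triangleE)
  have e': "add_edge u v E b a" "add_edge u v E c b" "add_edge u v E a c"
    using e sym[of a b] sym[of b c] sym[of c a] by (auto simp: add_edge_def insert_commute)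
  have *: thesis if "T = {u, p, v}" "distinct [u, p, v]" "add_edge u v E u p" "add_edge u v E p v" for p
    using cherry[of p] that by (auto simp: add_edge_def doubleton_eq_iff)
  have "u \<in> {a, b, c}" "v \<in> {a, b, c}"
    using assms(2) T(1) by auto
  then consider "u = a" "v = b" | "u = a" "v = c" | "u = b" "v = a" | "u = b" "v = c"
    | "u = c" "v = a" | "u = c" "v = b"
    using assms(3) by auto
  then show ?thesis
  proof cases
    case 1
    then show ?thesis
      using *[of c] T e e' by (auto simp: insert_commute)
  next
    case 2
    then show ?thesis
      using *[of b] T e e' by (auto simp: insert_commute)
  next
    case 3
    then show ?thesis
      using *[of c] T e e' by (auto simp: insert_commute)
  next
    case 4
    then show ?thesis
      using *[of a] T e e' by (auto simp: insert_commute)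
  next
    case 5
    then show ?thesis
      using *[of b] T e e' by (auto simp: insert_commute)
  next
    case 6
    then show ?thesis
      using *[of a] T e e' by (auto simp: insert_commute)
  qed
qed

text \<open>The four sides are distinct pairs, so at most one is the new edge; omitting it leaves
  the path.\<close>

lemma quad_add_edge_path:
  assumes "is_quad W (add_edge u v E) Q"
  obtains w x y z where "Q = {w, x, y, z}" "distinct [w, x, y, z]" "E w x" "E x y" "E y z"
proof -
  obtain a b c d where Q: "Q = {a, b, c, d}" "distinct [a, b, c, d]"
    and e: "add_edge u v E a b" "add_edge u v E b c" "add_edge u v E c d" "add_edge u v E d a"
    using assms by (elim is_quadE)
  have "E a b \<or> {a, b} = {u, v}" "E b c \<or> {b, c} = {u, v}" "E c d \<or> {c, d} = {u, v}"
    "E d a \<or> {d, a} = {u, v}"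
    using e by (auto simp: add_edge_def)
  moreover have "{a, b} \<noteq> {b, c}" "{a, b} \<noteq> {c, d}" "{a, b} \<noteq> {d, a}" "{b, c} \<noteq> {c, d}"
    "{b, c} \<noteq> {d, a}" "{c, d} \<noteq> {d, a}"
    using Q(2) by (auto simp: doubleton_eq_iff)
  ultimately consider "E a b" "E b c" "E c d" | "E b c" "E c d" "E d a" | "E c d" "E d a" "E a b"
    | "E d a" "E a b" "E b c"
    by metis
  then show ?thesis
  proof cases
    case 1
    then show ?thesis
      using Q by (intro that[of a b c d])
  next
    case 2
    then show ?thesis
      using Q by (intro that[of b c d a]) auto
  next
    case 3
    then show ?thesis
      using Q by (intro that[of c d a b]) auto
  next
    case 4
    then show ?thesis
      using Q by (intro that[of d a b c]) auto
  qed
qed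

lemma nb_mono:
  assumes "finite S" "\<And>y. E v y \<Longrightarrow> E' v y"
  shows "nb E v S \<le> nb E' v S"
  unfolding nb_def using assms by (intro card_mono) auto

lemma packs_of_ore_graph:
  assumes "ore_graph V E r s" "1 \<le> r" "1 \<le> s" "2 * s \<le> r + 2"
  shows "packs E V r s"
  using assms(1)
\<comment> \<open>Induction on the number of nonadjacent ordered pairs. Diagonal pairs are included
  but never change, as only edges between distinct vertices are added.\<close>
proof (induction "card {p \<in> V \<times> V. \<not> E (fst p) (snd p)}" arbitrary: E rule: less_induct)
  case less
  interpret ore_graph V E r s
    by (rule less.prems)
  show ?case
  proof (cases "\<forall>u\<in>V. \<forall>v\<in>V. u \<noteq> v \<longrightarrow> E u v")
    case True
    then show ?thesis
      using finite_V card_V by (intro packs_complete) auto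
  next
    case False
    then obtain u v where uv: "u \<in> V" "v \<in> V" "u \<noteq> v" "\<not> E u v"
      by blast
    let ?E = "add_edge u v E"
    have "simple_graph V ?E"
      using simple uv by (auto simp: simple_graph_def add_edge_def doubleton_eq_iff)
    moreover have "4 * (r + s) \<le> nb ?E x V + nb ?E y V"
      if "x \<in> V" "y \<in> V" "x \<noteq> y" "\<not> ?E x y" for x y
    proof -
      have "4 * (r + s) \<le> nb E x V + nb E y V"
        using ore[of x y] that by (simp add: add_edge_def)
      also have "\<dots> \<le> nb ?E x V + nb ?E y V"
        using finite_V by (intro add_mono nb_mono) (auto simp: add_edge_def)
      finally show ?thesis .
    qed
    ultimately have "ore_graph V ?E r s"
      using card_V by unfold_locales
    moreover have "card {p \<in> V \<times> V. \<not> ?E (fst p) (snd p)} < card {p \<in> V \<times> V. \<not> E (fst p) (snd p)}"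
    proof (rule psubset_card_mono)
      have "(u, v) \<in> {p \<in> V \<times> V. \<not> E (fst p) (snd p)} - {p \<in> V \<times> V. \<not> ?E (fst p) (snd p)}"
        using uv by (simp add: add_edge_def)
      moreover have "{p \<in> V \<times> V. \<not> ?E (fst p) (snd p)} \<subseteq> {p \<in> V \<times> V. \<not> E (fst p) (snd p)}"
        by (auto simp: add_edge_def)
      ultimately show "{p \<in> V \<times> V. \<not> ?E (fst p) (snd p)} \<subset> {p \<in> V \<times> V. \<not> E (fst p) (snd p)}"
        by blast
    qed (use finite_V in auto)
    ultimately have "packs ?E V r s"
      by (intro less.hyps)
    then obtain TT QQ where F: "family ?E V TT QQ" and cards: "card TT = r" "card QQ = s"
      by (auto simp: packs_def)
    have "packs E V r s \<or> packs E V (r + 1) (s - 1)"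
    proof -
      consider T where "T \<in> TT" "{u, v} \<subseteq> T" | Q where "Q \<in> QQ" "{u, v} \<subseteq> Q"
        | "\<forall>C\<in>TT \<union> QQ. \<not> {u, v} \<subseteq> C"
        by blast
      then show ?thesis
      proof cases
        case (1 T)
        have T: "is_triangle V ?E T"
          using F 1 by (simp add: family_def)
        obtain p where p: "T = {u, p, v}" "distinct [u, p, v]" "E u p" "E p v"
          using triangle_add_edge_cherry[OF T 1(2) uv(3) commute] .
        \<comment> \<open>Replacement by the empty packing simply deletes \<open>T\<close>. The
          remaining cycles avoid \<open>u\<close> and \<open>v\<close>, so they do not use the new
          edge.\<close>
        have "packs ?E (V - T) (r - 1) s"
          using family_replace[OF F, of "{T}" "{}" "{}" 0 0] 1(1) cards packs_0[of ?E "{}"] by simp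
        then have "packs E (V - {u, p, v}) (r - 1) s"
          unfolding p(1)[symmetric] by (rule packs_add_edgeD) (use 1(2) in auto)
        moreover have "{u, p, v} \<subseteq> V"
          using is_triangleD[OF T] p(1) by simp
        ultimately show ?thesis
          using packs_of_cherry[OF p(3,4,2)] assms(2,3) by blast
      next
        case (2 Q)
        have Q: "is_quad V ?E Q"
          using F 2 by (simp add: family_def)
        obtain w x y z where p: "Q = {w, x, y, z}" "distinct [w, x, y, z]" "E w x" "E x y" "E y z"
          using quad_add_edge_path[OF Q] .
        have "packs ?E (V - Q) r (s - 1)"
          using family_replace[OF F, of "{}" "{Q}" "{}" 0 0] 2(1) cards packs_0[of ?E "{}"] by simp
        then have "packs E (V - {w, x, y, z}) r (s - 1)"
          unfolding p(1)[symmetric] by (rule packs_add_edgeD) (use 2(2) in auto)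
        moreover have "{w, x, y, z} \<subseteq> V"
          using is_quadD[OF Q] p(1) by simp
        ultimately show ?thesis
          using packs_of_path[OF p(3-5,2)] assms(3) by blast
      next
        case 3
        then have "family E V TT QQ"
          using F is_triangle_add_edgeD[of V u v E] is_quad_add_edgeD[of V u v E]
          unfolding family_def by simp
        then show ?thesis
          using cards unfolding packs_def by blast
      qed
    qed
    then show ?thesis
      using packs_of_triangles_and_vertex assms(3,4) by blast
  qed
qed

theorem theorem2:
  fixes V :: "'a set" and E :: "'a \<Rightarrow> 'a \<Rightarrow> bool" and r s :: nat
  assumes "simple_graph V E"
    and "r \<ge> 1" and "s \<ge> 1" and "r \<ge> 2 * s - 2"
    and "card V = 3 * r + 4 * s"
    and "sigma2 V E \<ge> enat (card V + r)"
  shows "\<exists>T Q. (\<forall>i<r. is_triangle V E (T i)) \<and> (\<forall>j<s. is_quad V E (Q j))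
           \<and> (\<forall>i<r. \<forall>i'<r. i \<noteq> i' \<longrightarrow> T i \<inter> T i' = {})
           \<and> (\<forall>j<s. \<forall>j'<s. j \<noteq> j' \<longrightarrow> Q j \<inter> Q j' = {})
           \<and> (\<forall>i<r. \<forall>j<s. T i \<inter> Q j = {})"
proof -
  have "4 * (r + s) \<le> nb E x V + nb E y V" if "x \<in> V" "y \<in> V" "x \<noteq> y" "\<not> E x y" for x y
  proof -
    have "sigma2 V E \<le> enat (degree V E (fst (x, y)) + degree V E (snd (x, y)))"
      unfolding sigma2_def by (rule INF_lower) (use that in simp)
    from order_trans[OF assms(6) this] show ?thesis
      using assms(5) by (simp add: nb_def degree_def)
  qed
  then have "ore_graph V E r s"
    using assms(1,5) by unfold_locales
  then have "packs E V r s"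
    using assms(2-4) by (intro packs_of_ore_graph) auto
  then obtain TT QQ where F: "family E V TT QQ" and cards: "card TT = r" "card QQ = s"
    by (auto simp: packs_def)
  have "finite TT" "finite QQ"
    using F by (auto simp: family_def)
  \<comment> \<open>Bijections number the cycles; their injectivity turns distinct indices into
    distinct, hence disjoint, cycles.\<close>
  then obtain T Q where T: "bij_betw T {0..<r} TT" and Q: "bij_betw Q {0..<s} QQ"
    using ex_bij_betw_nat_finite[of TT] ex_bij_betw_nat_finite[of QQ] cards by auto
  have T_in: "T i \<in> TT" if "i < r" for i
    using bij_betwE[OF T] that by simp
  have Q_in: "Q j \<in> QQ" if "j < s" for j
    using bij_betwE[OF Q] that by simp
  have "T i \<inter> T i' = {}" if "i < r" "i' < r" "i \<noteq> i'" for i i'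
  proof (rule family_disjoint[OF F])
    show "T i \<noteq> T i'"
      using bij_betw_imp_inj_on[OF T] that by (simp add: inj_on_eq_iff)
  qed (use T_in that in auto)
  moreover have "Q j \<inter> Q j' = {}" if "j < s" "j' < s" "j \<noteq> j'" for j j'
  proof (rule family_disjoint[OF F])
    show "Q j \<noteq> Q j'"
      using bij_betw_imp_inj_on[OF Q] that by (simp add: inj_on_eq_iff)
  qed (use Q_in that in auto)
  moreover have "T i \<inter> Q j = {}" if "i < r" "j < s" for i j
    using F T_in[OF that(1)] Q_in[OF that(2)] by (rule family_disjoint_triangle_quad)
  moreover have "is_triangle V E (T i)" if "i < r" for i
    using F T_in[OF that] by (simp add: family_def)
  moreover have "is_quad V E (Q j)" if "j < s" for j
    using F Q_in[OF that] by (simp add: family_def)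
  ultimately show ?thesis
    by (intro exI[of _ T] exI[of _ Q] conjI allI impI)
qed

end
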